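(* Let $G$ be an internal groupoid in $\mathsf{C}$ and $(A,B,\mu)$ the crossed module in $\mathsf{C}$ corresponding to $G$. Then the category of internal normal subgroupoids of $G$ and the category of normal subcrossed modules of $(A,B,\mu)$ are equivalent.
   Context: Groups with operations. $\mathsf{C}$ is a fixed category of groups with operations: its objects are the algebras with a set $\Omega$ of operations satisfying a set $\mathsf{E}$ of identities, where $\mathsf{E}$ includes the group laws and, with $\Omega_i$ the set of $i$-ary operations: (a) $\Omega=\Omega_0\cup\Omega_1\cup\Omega_2$; (b) the group operations $0,-,+$ (written additively, $+$ not necessarily commutative) belong to $\Omega_0,\Omega_1,\Omega_2$ respectively, $\Omega_0=\{0\}$, and with $\Omega_1'=\Omega_1\setminus\{-\}$, $\Omega_2'=\Omega_2\setminus\{+\}$, if $\star\in\Omega_2'$ then the operation $a\star^{\circ}b=b\star a$ is also in $\Omega_2'$; (c) for each $\star\in\Omega_2'$, $\mathsf{E}$ includes $a\star(b+c)=a\star b+a\star c$; (d) for $\omega\in\Omega_1'$, $\star\in\Omega_2'$, $\mathsf{E}$ includes $\omega(a+b)=\omega(a)+\omega(b)$ and $\omega(a)\star b=\omega(a\star b)$. Morphisms are group homomorphisms preserving all operations in $\Omega_1'$ and $\Omega_2'$. A subobject is a subset containing $0$ and closed under all operations. An ideal $N$ of $A$ is a subobject with $(N,+)$ normal in $(A,+)$ and $a\star n\in N$ for all $a\in A$, $n\in N$, $\star\in\Omega_2'$. Crossed modules. Derived actions of $B$ on $A$ (objects of $\mathsf{C}$) are the maps $b\cdot a=s(b)+a-s(b)$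 and $b\star a=s(b)\star a$ ($\star\in\Omega_2'$) obtained from a split extension $0\to A\to E\xrightarrow{p}B\to 0$ in $\mathsf{C}$ ($p$ surjective, $A=\ker p$, $s\colon B\to E$ a morphism with $ps=\mathrm{id}_B$). One writes $a\star b:=b\star^{\circ}a$. A crossed module $(A,B,\alpha)$ in $\mathsf{C}$ consists of objects $A,B$, derived actions of $B$ on $A$, and a morphism $\alpha\colon A\to B$ such that for all $b\in B$, $a,a'\in A$, $\star\in\Omega_2'$: $\alpha(b\cdot a)=b+\alpha(a)-b$; $\alpha(a)\cdot a'=a+a'-a$; $\alpha(a)\star a'=a\star a'$; $\alpha(b\star a)=b\star\alpha(a)$ and $\alpha(a\star b)=\alpha(a)\star b$. A crossed module $(S,T,\sigma)$ is a subcrossed module of $(A,B,\alpha)$ if $S\subseteq A$ and $T\subseteq B$ are subobjects, $\sigma$ is the restriction of $\alpha$, and the actions of $T$ on $S$ are induced by those of $B$ on $A$. It is normal if: $T$ is an ideal of $B$; $b\cdot s\in S$, $(t\cdot a)-a\in S$, $b\star s\in S$, $t\star a\in S$ for all $b\in B,s\in S,t\in T,a\in A$, $\star\in\Omega_2'$. Internal groupoids. An internal groupoid $G$ in $\mathsf{C}$ is a groupoid whose set of objects $G_0$ and set of morphisms $G_1$ are objects of $\mathsf{C}$ and whose source and target maps $d_0,d_1\colon G_1\to G_0$, identity map $x\mapsto 1_x$, and partial composition are morphisms in $\mathsf{C}$. A subgroupoid $N$ of $G$ (subsets $N_1\subseteq G_1$, $N_0\subseteq G_0$ closed under source, target, identities,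 composition and inversion) is an internal normal subgroupoid if $N_1$ is an ideal of $G_1$. The crossed module corresponding to $G$ is $(\ker d_0, G_0, d_1|_{\ker d_0})$ with actions $b\cdot a=1_b+a-1_b$ and $b\star a=1_b\star a$. Both categories in the claim have as morphisms the morphisms (of internal groupoids, respectively crossed modules) commuting with the inclusions into $G$, respectively $(A,B,\mu)$; that is, inclusions. *)

theory Defs
  imports "HOL-Algebra.Coset"
begin

section \<open>Categories and their equivalence\<close>

record ('o, 'm) cat =
  Obj :: "'o set"
  Arr :: "'m set"
  Dom :: "'m \<Rightarrow> 'o"
  Cod :: "'m \<Rightarrow> 'o"
  Ident :: "'o \<Rightarrow> 'm"
  Cmp :: "'m \<Rightarrow> 'm \<Rightarrow> 'm"  \<comment> \<open>\<open>Cmp C g f\<close> is \<open>g\<close> after \<open>f\<close>\<close>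

locale category =
  fixes C :: "('o, 'm) cat"
  assumes Dom_closed: "f \<in> Arr C \<Longrightarrow> Dom C f \<in> Obj C"
    and Cod_closed: "f \<in> Arr C \<Longrightarrow> Cod C f \<in> Obj C"
    and Ident_arr: "x \<in> Obj C \<Longrightarrow> Ident C x \<in> Arr C"
    and Dom_Ident: "x \<in> Obj C \<Longrightarrow> Dom C (Ident C x) = x"
    and Cod_Ident: "x \<in> Obj C \<Longrightarrow> Cod C (Ident C x) = x"
    and Cmp_arr: "\<lbrakk>f \<in> Arr C; g \<in> Arr C; Dom C g = Cod C f\<rbrakk> \<Longrightarrow> Cmp C g f \<in> Arr C"
    and Dom_Cmp: "\<lbrakk>f \<in> Arr C; g \<in> Arr C; Dom C g = Cod C f\<rbrakk> \<Longrightarrow> Dom C (Cmp C g f) = Dom C f"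
    and Cod_Cmp: "\<lbrakk>f \<in> Arr C; g \<in> Arr C; Dom C g = Cod C f\<rbrakk> \<Longrightarrow> Cod C (Cmp C g f) = Cod C g"
    and Cmp_Ident_right: "f \<in> Arr C \<Longrightarrow> Cmp C f (Ident C (Dom C f)) = f"
    and Cmp_Ident_left: "f \<in> Arr C \<Longrightarrow> Cmp C (Ident C (Cod C f)) f = f"
    and Cmp_assoc: "\<lbrakk>f \<in> Arr C; g \<in> Arr C; h \<in> Arr C; Dom C g = Cod C f; Dom C h = Cod C g\<rbrakk>
      \<Longrightarrow> Cmp C h (Cmp C g f) = Cmp C (Cmp C h g) f"

definition inverse_arrows :: "('o, 'm) cat \<Rightarrow> 'm \<Rightarrow> 'm \<Rightarrow> bool" where
  "inverse_arrows C f g \<longleftrightarrow>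
     f \<in> Arr C \<and> g \<in> Arr C \<and> Dom C g = Cod C f \<and> Cod C g = Dom C f \<and>
     Cmp C g f = Ident C (Dom C f) \<and> Cmp C f g = Ident C (Cod C f)"

locale groupoid = category C for C :: "('o, 'm) cat" +
  assumes ex_inverse: "f \<in> Arr C \<Longrightarrow> \<exists>g. inverse_arrows C f g"

locale is_functor =
  fixes C :: "('o, 'm) cat" and D :: "('p, 'n) cat"
    and Fo :: "'o \<Rightarrow> 'p" and Fa :: "'m \<Rightarrow> 'n"
  assumes Fo_closed: "x \<in> Obj C \<Longrightarrow> Fo x \<in> Obj D"
    and Fa_closed: "f \<in> Arr C \<Longrightarrow> Fa f \<in> Arr D"
    and Fa_Dom: "f \<in> Arr C \<Longrightarrow> Dom D (Fa f) = Fo (Dom C f)"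
    and Fa_Cod: "f \<in> Arr C \<Longrightarrow> Cod D (Fa f) = Fo (Cod C f)"
    and Fa_Ident: "x \<in> Obj C \<Longrightarrow> Fa (Ident C x) = Ident D (Fo x)"
    and Fa_Cmp: "\<lbrakk>f \<in> Arr C; g \<in> Arr C; Dom C g = Cod C f\<rbrakk>
      \<Longrightarrow> Fa (Cmp C g f) = Cmp D (Fa g) (Fa f)"

locale natural_isomorphism =
  fixes C :: "('o, 'm) cat" and D :: "('p, 'n) cat"
    and Fo :: "'o \<Rightarrow> 'p" and Fa :: "'m \<Rightarrow> 'n"
    and Ho :: "'o \<Rightarrow> 'p" and Ha :: "'m \<Rightarrow> 'n"
    and \<tau> :: "'o \<Rightarrow> 'n"
  assumes iso: "x \<in> Obj C \<Longrightarrow> \<exists>g. inverse_arrows D (\<tau> x) g"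
    and component_Dom: "x \<in> Obj C \<Longrightarrow> Dom D (\<tau> x) = Fo x"
    and component_Cod: "x \<in> Obj C \<Longrightarrow> Cod D (\<tau> x) = Ho x"
    and naturality: "f \<in> Arr C \<Longrightarrow>
      Cmp D (\<tau> (Cod C f)) (Fa f) = Cmp D (Ha f) (\<tau> (Dom C f))"

definition equivalent_categories :: "('o, 'm) cat \<Rightarrow> ('p, 'n) cat \<Rightarrow> bool" where
  "equivalent_categories C D \<longleftrightarrow>
     category C \<and> category D \<and>
     (\<exists>Fo Fa Ho Ha \<eta> \<epsilon>.
        is_functor C D Fo Fa \<and> is_functor D C Ho Ha \<and>
        natural_isomorphism C C (\<lambda>x. x) (\<lambda>f. f) (Ho \<circ> Fo) (Ha \<circ> Fa) \<eta> \<and>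
        natural_isomorphism D D (Fo \<circ> Ho) (Fa \<circ> Ha) (\<lambda>x. x) (\<lambda>f. f) \<epsilon>)"


section \<open>Groups with operations\<close>

text \<open>
  The symbols \<open>0\<close>, \<open>-\<close>, \<open>+\<close> are built into the terms; \<open>App1\<close> and \<open>App2\<close> apply the
  remaining unary and binary operation symbols.
\<close>

datatype ('u, 'w) opterm =
    Var nat
  | Zero
  | Neg "('u, 'w) opterm"
  | Plus "('u, 'w) opterm" "('u, 'w) opterm"
  | App1 'u "('u, 'w) opterm"
  | App2 'w "('u, 'w) opterm" "('u, 'w) opterm"

text \<open>
  \<open>Om1\<close> and \<open>Om2\<close> are \<open>\<Omega>\<^sub>1' = \<Omega>\<^sub>1 \<setminus> {-}\<close> and \<open>\<Omega>\<^sub>2' = \<Omega>\<^sub>2 \<setminus> {+}\<close>; they are sets, not whole types,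
  because either may be empty (as for plain groups). \<open>opp\<close> sends \<open>\<star>\<close> to \<open>\<star>\<^sup>\<circ>\<close>, and \<open>Eqs\<close> is the
  set \<open>\<E>\<close> of identities, as pairs of terms.
\<close>

record ('u, 'w) optheory =
  Om1 :: "'u set"
  Om2 :: "'w set"
  opp :: "'w \<Rightarrow> 'w"
  Eqs :: "(('u, 'w) opterm \<times> ('u, 'w) opterm) set"

fun wf_term :: "('u, 'w) optheory \<Rightarrow> ('u, 'w) opterm \<Rightarrow> bool" where
  "wf_term \<T> (Var i) \<longleftrightarrow> True"
| "wf_term \<T> Zero \<longleftrightarrow> True"
| "wf_term \<T> (Neg t) \<longleftrightarrow> wf_term \<T> t"
| "wf_term \<T> (Plus t t') \<longleftrightarrow> wf_term \<T> t \<and> wf_term \<T> t'"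
| "wf_term \<T> (App1 \<omega> t) \<longleftrightarrow> \<omega> \<in> Om1 \<T> \<and> wf_term \<T> t"
| "wf_term \<T> (App2 \<sigma> t t') \<longleftrightarrow> \<sigma> \<in> Om2 \<T> \<and> wf_term \<T> t \<and> wf_term \<T> t'"

definition group_laws :: "(('u, 'w) opterm \<times> ('u, 'w) opterm) set" where
  "group_laws =
    {(Plus (Plus (Var 0) (Var 1)) (Var 2), Plus (Var 0) (Plus (Var 1) (Var 2))),
     (Plus Zero (Var 0), Var 0),
     (Plus (Var 0) Zero, Var 0),
     (Plus (Neg (Var 0)) (Var 0), Zero),
     (Plus (Var 0) (Neg (Var 0)), Zero)}"

locale groups_with_operations =
  fixes \<T> :: "('u, 'w) optheory"
  assumes Eqs_wf: "(l, r) \<in> Eqs \<T> \<Longrightarrow> wf_term \<T> l \<and> wf_term \<T> r"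
    and group_laws: "group_laws \<subseteq> Eqs \<T>"
    and opp_closed: "\<sigma> \<in> Om2 \<T> \<Longrightarrow> opp \<T> \<sigma> \<in> Om2 \<T>"
    and opp_law: "\<sigma> \<in> Om2 \<T> \<Longrightarrow>
      (App2 (opp \<T> \<sigma>) (Var 0) (Var 1), App2 \<sigma> (Var 1) (Var 0)) \<in> Eqs \<T>"
    and distrib_law: "\<sigma> \<in> Om2 \<T> \<Longrightarrow>
      (App2 \<sigma> (Var 0) (Plus (Var 1) (Var 2)),
       Plus (App2 \<sigma> (Var 0) (Var 1)) (App2 \<sigma> (Var 0) (Var 2))) \<in> Eqs \<T>"
    and additive_law: "\<omega> \<in> Om1 \<T> \<Longrightarrow>
      (App1 \<omega> (Plus (Var 0) (Var 1)), Plus (App1 \<omega> (Var 0)) (App1 \<omega> (Var 1))) \<in> Eqs \<T>"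
    and commute_law: "\<lbrakk>\<omega> \<in> Om1 \<T>; \<sigma> \<in> Om2 \<T>\<rbrakk> \<Longrightarrow>
      (App2 \<sigma> (App1 \<omega> (Var 0)) (Var 1), App1 \<omega> (App2 \<sigma> (Var 0) (Var 1))) \<in> Eqs \<T>"

text \<open>
  Algebras extend the library's monoid record, so \<open>\<otimes>\<close> and \<open>\<one>\<close> stand for the (not necessarily
  commutative) group operation \<open>+\<close> and its neutral element \<open>0\<close>.
\<close>

record ('a, 'u, 'w) opalg = "'a monoid" +
  neg :: "'a \<Rightarrow> 'a"
  un :: "'u \<Rightarrow> 'a \<Rightarrow> 'a"
  bin :: "'w \<Rightarrow> 'a \<Rightarrow> 'a \<Rightarrow> 'a"

primrec eval_term :: "('a, 'u, 'w) opalg \<Rightarrow> (nat \<Rightarrow> 'a) \<Rightarrow> ('u, 'w) opterm \<Rightarrow> 'a" where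
  "eval_term A \<rho> (Var i) = \<rho> i"
| "eval_term A \<rho> Zero = \<one>\<^bsub>A\<^esub>"
| "eval_term A \<rho> (Neg t) = neg A (eval_term A \<rho> t)"
| "eval_term A \<rho> (Plus t t') = eval_term A \<rho> t \<otimes>\<^bsub>A\<^esub> eval_term A \<rho> t'"
| "eval_term A \<rho> (App1 \<omega> t) = un A \<omega> (eval_term A \<rho> t)"
| "eval_term A \<rho> (App2 \<sigma> t t') = bin A \<sigma> (eval_term A \<rho> t) (eval_term A \<rho> t')"

definition op_closed :: "('u, 'w) optheory \<Rightarrow> 'a set \<Rightarrow> ('a, 'u, 'w) opalg \<Rightarrow> bool" where
  "op_closed \<T> S A \<longleftrightarrow>
     \<one>\<^bsub>A\<^esub> \<in> S \<and>
     (\<forall>a\<in>S. neg A a \<in> S) \<and>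
     (\<forall>a\<in>S. \<forall>b\<in>S. a \<otimes>\<^bsub>A\<^esub> b \<in> S) \<and>
     (\<forall>\<omega>\<in>Om1 \<T>. \<forall>a\<in>S. un A \<omega> a \<in> S) \<and>
     (\<forall>\<sigma>\<in>Om2 \<T>. \<forall>a\<in>S. \<forall>b\<in>S. bin A \<sigma> a b \<in> S)"

definition object :: "('u, 'w) optheory \<Rightarrow> ('a, 'u, 'w) opalg \<Rightarrow> bool" where
  "object \<T> A \<longleftrightarrow>
     op_closed \<T> (carrier A) A \<and>
     (\<forall>(l, r)\<in>Eqs \<T>. \<forall>\<rho>. range \<rho> \<subseteq> carrier A \<longrightarrow> eval_term A \<rho> l = eval_term A \<rho> r)"

definition morphism ::
  "('u, 'w) optheory \<Rightarrow> ('a, 'u, 'w) opalg \<Rightarrow> ('b, 'u, 'w) opalg \<Rightarrow> ('a \<Rightarrow> 'b) \<Rightarrow> bool" where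
  "morphism \<T> A B f \<longleftrightarrow>
     f \<in> hom A B \<and>
     (\<forall>\<omega>\<in>Om1 \<T>. \<forall>a\<in>carrier A. f (un A \<omega> a) = un B \<omega> (f a)) \<and>
     (\<forall>\<sigma>\<in>Om2 \<T>. \<forall>a\<in>carrier A. \<forall>a'\<in>carrier A. f (bin A \<sigma> a a') = bin B \<sigma> (f a) (f a'))"

definition subobject :: "('u, 'w) optheory \<Rightarrow> 'a set \<Rightarrow> ('a, 'u, 'w) opalg \<Rightarrow> bool" where
  "subobject \<T> S A \<longleftrightarrow> S \<subseteq> carrier A \<and> op_closed \<T> S A"

definition op_ideal :: "('u, 'w) optheory \<Rightarrow> 'a set \<Rightarrow> ('a, 'u, 'w) opalg \<Rightarrow> bool" where
  "op_ideal \<T> N A \<longleftrightarrow>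
     subobject \<T> N A \<and> N \<lhd> A \<and>
     (\<forall>\<sigma>\<in>Om2 \<T>. \<forall>a\<in>carrier A. \<forall>n\<in>N. bin A \<sigma> a n \<in> N)"


section \<open>Crossed modules\<close>

text \<open>
  Here \<open>dot b a\<close> and \<open>act \<sigma> b a\<close> are the maps \<open>b \<cdot> a\<close> and \<open>b \<star> a\<close>, where \<open>\<star>\<close> is the
  operation with symbol \<open>\<sigma>\<close>. The middle object of the split extension is taken on the type
  \<open>'a \<times> 'b\<close>. This loses no generality: every split extension of \<open>B\<close> by \<open>A\<close> has underlying set
  in bijection with the product of the carriers of \<open>A\<close> and \<open>B\<close>, so it is isomorphic to one on
  this type. The map \<open>i\<close> identifies \<open>A\<close> with the kernel of \<open>p\<close>.
\<close>

definition derived_action ::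
  "('u, 'w) optheory \<Rightarrow> ('b, 'u, 'w) opalg \<Rightarrow> ('a, 'u, 'w) opalg \<Rightarrow>
   ('b \<Rightarrow> 'a \<Rightarrow> 'a) \<Rightarrow> ('w \<Rightarrow> 'b \<Rightarrow> 'a \<Rightarrow> 'a) \<Rightarrow> bool" where
  "derived_action \<T> B A dot act \<longleftrightarrow>
     (\<exists>(E :: ('a \<times> 'b, 'u, 'w) opalg) i p s.
        object \<T> E \<and> morphism \<T> A E i \<and> morphism \<T> E B p \<and> morphism \<T> B E s \<and>
        inj_on i (carrier A) \<and> i ` carrier A = kernel E B p \<and>
        p ` carrier E = carrier B \<and> (\<forall>b\<in>carrier B. p (s b) = b) \<and>
        (\<forall>b\<in>carrier B. \<forall>a\<in>carrier A.
           dot b a \<in> carrier A \<and> i (dot b a) = s b \<otimes>\<^bsub>E\<^esub> i a \<otimes>\<^bsub>E\<^esub> neg E (s b)) \<and>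
        (\<forall>\<sigma>\<in>Om2 \<T>. \<forall>b\<in>carrier B. \<forall>a\<in>carrier A.
           act \<sigma> b a \<in> carrier A \<and> i (act \<sigma> b a) = bin E \<sigma> (s b) (i a)))"

record ('a, 'b, 'u, 'w) xmod =
  fibre :: "('a, 'u, 'w) opalg"
  base :: "('b, 'u, 'w) opalg"
  bdry :: "'a \<Rightarrow> 'b"
  dot :: "'b \<Rightarrow> 'a \<Rightarrow> 'a"
  act :: "'w \<Rightarrow> 'b \<Rightarrow> 'a \<Rightarrow> 'a"

text \<open>In the last law, \<open>a \<star> b\<close> abbreviates \<open>b \<star>\<^sup>\<circ> a\<close>.\<close>

locale crossed_module =
  fixes \<T> :: "('u, 'w) optheory" and X :: "('a, 'b, 'u, 'w) xmod"
  assumes fibre_object: "object \<T> (fibre X)"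
    and base_object: "object \<T> (base X)"
    and action: "derived_action \<T> (base X) (fibre X) (dot X) (act X)"
    and bdry_morphism: "morphism \<T> (fibre X) (base X) (bdry X)"
    and bdry_dot: "\<lbrakk>b \<in> carrier (base X); a \<in> carrier (fibre X)\<rbrakk> \<Longrightarrow>
      bdry X (dot X b a) = b \<otimes>\<^bsub>base X\<^esub> bdry X a \<otimes>\<^bsub>base X\<^esub> neg (base X) b"
    and peiffer_dot: "\<lbrakk>a \<in> carrier (fibre X); a' \<in> carrier (fibre X)\<rbrakk> \<Longrightarrow>
      dot X (bdry X a) a' = a \<otimes>\<^bsub>fibre X\<^esub> a' \<otimes>\<^bsub>fibre X\<^esub> neg (fibre X) a"
    and peiffer_act: "\<lbrakk>\<sigma> \<in> Om2 \<T>; a \<in> carrier (fibre X); a' \<in> carrier (fibre X)\<rbrakk> \<Longrightarrow>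
      act X \<sigma> (bdry X a) a' = bin (fibre X) \<sigma> a a'"
    and bdry_act: "\<lbrakk>\<sigma> \<in> Om2 \<T>; b \<in> carrier (base X); a \<in> carrier (fibre X)\<rbrakk> \<Longrightarrow>
      bdry X (act X \<sigma> b a) = bin (base X) \<sigma> b (bdry X a)"
    and bdry_act_opp: "\<lbrakk>\<sigma> \<in> Om2 \<T>; b \<in> carrier (base X); a \<in> carrier (fibre X)\<rbrakk> \<Longrightarrow>
      bdry X (act X (opp \<T> \<sigma>) b a) = bin (base X) \<sigma> (bdry X a) b"

locale xmod_morphism =
  fixes \<T> :: "('u, 'w) optheory"
    and X :: "('a, 'b, 'u, 'w) xmod" and Y :: "('c, 'd, 'u, 'w) xmod"
    and f :: "'a \<Rightarrow> 'c" and g :: "'b \<Rightarrow> 'd"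
  assumes fibre_morphism: "morphism \<T> (fibre X) (fibre Y) f"
    and base_morphism: "morphism \<T> (base X) (base Y) g"
    and bdry_commute: "a \<in> carrier (fibre X) \<Longrightarrow> bdry Y (f a) = g (bdry X a)"
    and dot_preserve: "\<lbrakk>b \<in> carrier (base X); a \<in> carrier (fibre X)\<rbrakk> \<Longrightarrow>
      f (dot X b a) = dot Y (g b) (f a)"
    and act_preserve: "\<lbrakk>\<sigma> \<in> Om2 \<T>; b \<in> carrier (base X); a \<in> carrier (fibre X)\<rbrakk> \<Longrightarrow>
      f (act X \<sigma> b a) = act Y \<sigma> (g b) (f a)"

text \<open>
  Restricted structures keep the operations, boundary map and actions of the ambient structure as
  total functions and only change the carriers, so a subcrossed module (and, below, a
  subgroupoid) is determined by its two underlying sets.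
\<close>

definition restrict_xmod ::
  "('a, 'b, 'u, 'w) xmod \<Rightarrow> 'a set \<Rightarrow> 'b set \<Rightarrow> ('a, 'b, 'u, 'w) xmod" where
  "restrict_xmod X S T =
     X\<lparr>fibre := (fibre X)\<lparr>carrier := S\<rparr>, base := (base X)\<lparr>carrier := T\<rparr>\<rparr>"

definition subcrossed_module ::
  "('u, 'w) optheory \<Rightarrow> ('a, 'b, 'u, 'w) xmod \<Rightarrow> ('a, 'b, 'u, 'w) xmod \<Rightarrow> bool" where
  "subcrossed_module \<T> Y X \<longleftrightarrow>
     (\<exists>S T. subobject \<T> S (fibre X) \<and> subobject \<T> T (base X) \<and> Y = restrict_xmod X S T) \<and>
     crossed_module \<T> Y"

definition normal_subcrossed_module ::
  "('u, 'w) optheory \<Rightarrow> ('a, 'b, 'u, 'w) xmod \<Rightarrow> ('a, 'b, 'u, 'w) xmod \<Rightarrow> bool" where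
  "normal_subcrossed_module \<T> Y X \<longleftrightarrow>
     subcrossed_module \<T> Y X \<and>
     op_ideal \<T> (carrier (base Y)) (base X) \<and>
     (\<forall>b\<in>carrier (base X). \<forall>s\<in>carrier (fibre Y). dot X b s \<in> carrier (fibre Y)) \<and>
     (\<forall>t\<in>carrier (base Y). \<forall>a\<in>carrier (fibre X).
        dot X t a \<otimes>\<^bsub>fibre X\<^esub> neg (fibre X) a \<in> carrier (fibre Y)) \<and>
     (\<forall>\<sigma>\<in>Om2 \<T>. \<forall>b\<in>carrier (base X). \<forall>s\<in>carrier (fibre Y). act X \<sigma> b s \<in> carrier (fibre Y)) \<and>
     (\<forall>\<sigma>\<in>Om2 \<T>. \<forall>t\<in>carrier (base Y). \<forall>a\<in>carrier (fibre X). act X \<sigma> t a \<in> carrier (fibre Y))"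

text \<open>
  An arrow \<open>(Y, f, g, Z)\<close> consists of a morphism \<open>(f, g)\<close> from \<open>Y\<close> to \<open>Z\<close> commuting with the
  inclusions into \<open>X\<close>. The maps are extensional so that equal morphisms are equal as functions.
\<close>

definition normal_subcrossed_module_cat ::
  "('u, 'w) optheory \<Rightarrow> ('a, 'b, 'u, 'w) xmod \<Rightarrow>
   (('a, 'b, 'u, 'w) xmod,
    ('a, 'b, 'u, 'w) xmod \<times> ('a \<Rightarrow> 'a) \<times> ('b \<Rightarrow> 'b) \<times> ('a, 'b, 'u, 'w) xmod) cat" where
  "normal_subcrossed_module_cat \<T> X = \<lparr>
     Obj = {Y. normal_subcrossed_module \<T> Y X},
     Arr = {(Y, f, g, Z).
        normal_subcrossed_module \<T> Y X \<and> normal_subcrossed_module \<T> Z X \<and>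
        xmod_morphism \<T> Y Z f g \<and>
        f \<in> extensional (carrier (fibre Y)) \<and> g \<in> extensional (carrier (base Y)) \<and>
        (\<forall>a\<in>carrier (fibre Y). f a = a) \<and> (\<forall>b\<in>carrier (base Y). g b = b)},
     Dom = (\<lambda>(Y, f, g, Z). Y),
     Cod = (\<lambda>(Y, f, g, Z). Z),
     Ident = (\<lambda>Y. (Y, restrict (\<lambda>a. a) (carrier (fibre Y)), restrict (\<lambda>b. b) (carrier (base Y)), Y)),
     Cmp = (\<lambda>(Y', f', g', Z') (Y, f, g, Z).
        (Y, compose (carrier (fibre Y)) f' f, compose (carrier (base Y)) g' g, Z'))\<rparr>"


section \<open>Internal groupoids\<close>

record ('o, 'm, 'u, 'w) igpd =
  objs :: "('o, 'u, 'w) opalg"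
  arrs :: "('m, 'u, 'w) opalg"
  src :: "'m \<Rightarrow> 'o"
  tgt :: "'m \<Rightarrow> 'o"
  idt :: "'o \<Rightarrow> 'm"
  cmp :: "'m \<Rightarrow> 'm \<Rightarrow> 'm"

definition underlying_cat :: "('o, 'm, 'u, 'w) igpd \<Rightarrow> ('o, 'm) cat" where
  "underlying_cat G = \<lparr>Obj = carrier (objs G), Arr = carrier (arrs G),
     Dom = src G, Cod = tgt G, Ident = idt G, Cmp = cmp G\<rparr>"

text \<open>The pullback of source and target, with componentwise operations: the domain of composition.\<close>

definition composable_pairs :: "('o, 'm, 'u, 'w) igpd \<Rightarrow> ('m \<times> 'm, 'u, 'w) opalg" where
  "composable_pairs G = \<lparr>
     carrier = {(b, a). b \<in> carrier (arrs G) \<and> a \<in> carrier (arrs G) \<and> src G b = tgt G a},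
     monoid.mult = (\<lambda>(b, a) (b', a'). (b \<otimes>\<^bsub>arrs G\<^esub> b', a \<otimes>\<^bsub>arrs G\<^esub> a')),
     one = (\<one>\<^bsub>arrs G\<^esub>, \<one>\<^bsub>arrs G\<^esub>),
     neg = (\<lambda>(b, a). (neg (arrs G) b, neg (arrs G) a)),
     un = (\<lambda>\<omega> (b, a). (un (arrs G) \<omega> b, un (arrs G) \<omega> a)),
     bin = (\<lambda>\<sigma> (b, a) (b', a'). (bin (arrs G) \<sigma> b b', bin (arrs G) \<sigma> a a'))\<rparr>"

locale internal_groupoid =
  fixes \<T> :: "('u, 'w) optheory" and G :: "('o, 'm, 'u, 'w) igpd"
  assumes groupoid: "groupoid (underlying_cat G)"
    and objs_object: "object \<T> (objs G)"
    and arrs_object: "object \<T> (arrs G)"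
    and src_morphism: "morphism \<T> (arrs G) (objs G) (src G)"
    and tgt_morphism: "morphism \<T> (arrs G) (objs G) (tgt G)"
    and idt_morphism: "morphism \<T> (objs G) (arrs G) (idt G)"
    and cmp_morphism: "morphism \<T> (composable_pairs G) (arrs G) (\<lambda>(b, a). cmp G b a)"

locale igpd_morphism =
  fixes \<T> :: "('u, 'w) optheory"
    and G :: "('o, 'm, 'u, 'w) igpd" and H :: "('p, 'n, 'u, 'w) igpd"
    and f :: "'m \<Rightarrow> 'n" and g :: "'o \<Rightarrow> 'p"
  assumes arrs_morphism: "morphism \<T> (arrs G) (arrs H) f"
    and objs_morphism: "morphism \<T> (objs G) (objs H) g"
    and is_functor: "is_functor (underlying_cat G) (underlying_cat H) g f"

definition restrict_igpd ::
  "('o, 'm, 'u, 'w) igpd \<Rightarrow> 'm set \<Rightarrow> 'o set \<Rightarrow> ('o, 'm, 'u, 'w) igpd" where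
  "restrict_igpd G N1 N0 =
     G\<lparr>arrs := (arrs G)\<lparr>carrier := N1\<rparr>, objs := (objs G)\<lparr>carrier := N0\<rparr>\<rparr>"

definition subgroupoid :: "('o, 'm, 'u, 'w) igpd \<Rightarrow> ('o, 'm, 'u, 'w) igpd \<Rightarrow> bool" where
  "subgroupoid N G \<longleftrightarrow>
     (\<exists>N1 N0. N = restrict_igpd G N1 N0 \<and>
        N1 \<subseteq> carrier (arrs G) \<and> N0 \<subseteq> carrier (objs G) \<and>
        (\<forall>a\<in>N1. src G a \<in> N0 \<and> tgt G a \<in> N0) \<and>
        (\<forall>x\<in>N0. idt G x \<in> N1) \<and>
        (\<forall>a\<in>N1. \<forall>b\<in>N1. src G b = tgt G a \<longrightarrow> cmp G b a \<in> N1) \<and>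
        (\<forall>a\<in>N1. \<forall>b. inverse_arrows (underlying_cat G) a b \<longrightarrow> b \<in> N1))"

definition internal_normal_subgroupoid ::
  "('u, 'w) optheory \<Rightarrow> ('o, 'm, 'u, 'w) igpd \<Rightarrow> ('o, 'm, 'u, 'w) igpd \<Rightarrow> bool" where
  "internal_normal_subgroupoid \<T> N G \<longleftrightarrow>
     subgroupoid N G \<and> op_ideal \<T> (carrier (arrs N)) (arrs G)"

definition normal_subgroupoid_cat ::
  "('u, 'w) optheory \<Rightarrow> ('o, 'm, 'u, 'w) igpd \<Rightarrow>
   (('o, 'm, 'u, 'w) igpd,
    ('o, 'm, 'u, 'w) igpd \<times> ('m \<Rightarrow> 'm) \<times> ('o \<Rightarrow> 'o) \<times> ('o, 'm, 'u, 'w) igpd) cat" where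
  "normal_subgroupoid_cat \<T> G = \<lparr>
     Obj = {N. internal_normal_subgroupoid \<T> N G},
     Arr = {(M, f, g, N).
        internal_normal_subgroupoid \<T> M G \<and> internal_normal_subgroupoid \<T> N G \<and>
        igpd_morphism \<T> M N f g \<and>
        f \<in> extensional (carrier (arrs M)) \<and> g \<in> extensional (carrier (objs M)) \<and>
        (\<forall>a\<in>carrier (arrs M). f a = a) \<and> (\<forall>x\<in>carrier (objs M). g x = x)},
     Dom = (\<lambda>(M, f, g, N). M),
     Cod = (\<lambda>(M, f, g, N). N),
     Ident = (\<lambda>N. (N, restrict (\<lambda>a. a) (carrier (arrs N)), restrict (\<lambda>x. x) (carrier (objs N)), N)),
     Cmp = (\<lambda>(M', f', g', N') (M, f, g, N).
        (M, compose (carrier (arrs M)) f' f, compose (carrier (objs M)) g' g, N'))\<rparr>"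

definition xmod_of_igpd :: "('o, 'm, 'u, 'w) igpd \<Rightarrow> ('m, 'o, 'u, 'w) xmod" where
  "xmod_of_igpd G = \<lparr>
     fibre = (arrs G)\<lparr>carrier := kernel (arrs G) (objs G) (src G)\<rparr>,
     base = objs G,
     bdry = tgt G,
     dot = (\<lambda>b a. idt G b \<otimes>\<^bsub>arrs G\<^esub> a \<otimes>\<^bsub>arrs G\<^esub> neg (arrs G) (idt G b)),
     act = (\<lambda>\<sigma> b a. bin (arrs G) \<sigma> (idt G b) a)\<rparr>"

end

theory Submission
  imports Defs
begin

text \<open>
  Both categories are preorders in disguise: an object is a pair of carriers inside a fixed
  ambient structure, and a morphism commuting with the inclusions is itself an inclusion. So it
  suffices to give mutually inverse, monotone maps between the two classes of objects. Write
  \<open>K\<close> for the kernel of the source map, \<open>1\<^sub>x\<close> for the identity at \<open>x\<close>, and \<open>N\<^sub>1\<close>, \<open>N\<^sub>0\<close> for the arrows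
  and objects of a normal subgroupoid. The maps are
  \<open>(N\<^sub>1, N\<^sub>0) \<mapsto> (N\<^sub>1 \<inter> K, N\<^sub>0)\<close> and \<open>(S, T) \<mapsto> (S + 1\<^sub>T, T)\<close>; they are inverse to each other because every arrow
  \<open>a\<close> from \<open>x\<close> is uniquely \<open>k + 1\<^sub>x\<close> with \<open>k \<in> K\<close>, namely for \<open>k = a - 1\<^sub>x\<close>.

  Everything about composition comes from interchange, that is, from composition being a morphism
  on the pullback of source and target. It forces \<open>b \<circ> a = b - 1\<^sub>y + a\<close>, where \<open>y\<close> is the object
  between them (\<open>cmp_eq\<close>). Hence an ideal of arrows containing the identities at its sources and
  targets is closed under composition and inversion. Interchange also
  makes arrows out of \<open>0\<close> commute with, and annihilate, arrows into \<open>0\<close>; these are the Peiffer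
  identities (\<open>peiffer_plus\<close>, \<open>peiffer_bin\<close>).

  If \<open>N\<^sub>1\<close> is an ideal, the closure conditions on \<open>(N\<^sub>1 \<inter> K, N\<^sub>0)\<close> are instances of the ideal
  conditions, and \<open>N\<^sub>1\<close> itself, with source map and identities, is the split extension that
  exhibits the action of \<open>N\<^sub>0\<close> on \<open>N\<^sub>1 \<inter> K\<close> as a derived action (\<open>derived_actionI\<close>). Conversely,
  \<open>S + 1\<^sub>T\<close> is an ideal (\<open>op_ideal_arrows_over\<close>): an arbitrary arrow is \<open>u + 1\<^sub>b\<close> with \<open>u \<in> K\<close>, the
  summand \<open>1\<^sub>b\<close> is handled by stability of \<open>S\<close> under the action of \<open>b\<close>, and on \<open>S\<close> the
  summand \<open>u\<close> acts like its target by the Peiffer identities; on \<open>1\<^sub>T\<close> it is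
  handled by the conditions that \<open>(t \<cdot> u) - u\<close> and \<open>t \<star> u\<close> lie in \<open>S\<close>.
\<close>

section \<open>Categories of inclusions\<close>

text \<open>
  The preorder of all \<open>X\<close> with \<open>P X\<close>, ordered by inclusion of both carriers. Its arrows keep the
  extensional identity maps so that it can equal, and not merely be isomorphic to, a category of
  structure-preserving maps.
\<close>

definition inclusion_cat ::
  "('x \<Rightarrow> bool) \<Rightarrow> ('x \<Rightarrow> 'a set) \<Rightarrow> ('x \<Rightarrow> 'b set) \<Rightarrow>
   ('x, 'x \<times> ('a \<Rightarrow> 'a) \<times> ('b \<Rightarrow> 'b) \<times> 'x) cat" where
  "inclusion_cat P c d = \<lparr>
     Obj = {X. P X},
     Arr = {(X, f, g, Y). P X \<and> P Y \<and> c X \<subseteq> c Y \<and> d X \<subseteq> d Y \<and>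
        f = restrict (\<lambda>a. a) (c X) \<and> g = restrict (\<lambda>b. b) (d X)},
     Dom = (\<lambda>(X, f, g, Y). X),
     Cod = (\<lambda>(X, f, g, Y). Y),
     Ident = (\<lambda>X. (X, restrict (\<lambda>a. a) (c X), restrict (\<lambda>b. b) (d X), X)),
     Cmp = (\<lambda>(X', f', g', Y') (X, f, g, Y). (X, compose (c X) f' f, compose (d X) g' g, Y'))\<rparr>"

lemma compose_inclusions:
  "S \<subseteq> S' \<Longrightarrow> compose S (restrict (\<lambda>a. a) S') (restrict (\<lambda>a. a) S) = restrict (\<lambda>a. a) S"
  by (auto simp: compose_def fun_eq_iff)

lemma category_inclusion_cat: "category (inclusion_cat P c d)"
  by unfold_locales (auto simp: inclusion_cat_def compose_inclusions)

text \<open>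
  Commuting with the inclusions and being extensional pins down both maps, so only the
  existence of the arrow depends on the structure to be preserved.
\<close>

lemma inclusion_arrows:
  assumes mor: "\<And>X Y. \<lbrakk>P X; P Y\<rbrakk> \<Longrightarrow>
      mor X Y (restrict (\<lambda>a. a) (c X)) (restrict (\<lambda>b. b) (d X)) \<longleftrightarrow> c X \<subseteq> c Y \<and> d X \<subseteq> d Y"
  shows "{(X, f, g, Y). P X \<and> P Y \<and> mor X Y f g \<and> f \<in> extensional (c X) \<and> g \<in> extensional (d X) \<and>
      (\<forall>a\<in>c X. f a = a) \<and> (\<forall>b\<in>d X. g b = b)} = Arr (inclusion_cat P c d)"
proof -
  have ext: "f \<in> extensional S \<and> (\<forall>a\<in>S. f a = a) \<longleftrightarrow> f = restrict (\<lambda>a. a) S"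
    for f :: "'z \<Rightarrow> 'z" and S
    by (auto simp: extensional_def fun_eq_iff)
  have "(P X \<and> P Y \<and> mor X Y f g \<and> f \<in> extensional (c X) \<and> g \<in> extensional (d X) \<and>
      (\<forall>a\<in>c X. f a = a) \<and> (\<forall>b\<in>d X. g b = b)) \<longleftrightarrow>
    (P X \<and> P Y \<and> c X \<subseteq> c Y \<and> d X \<subseteq> d Y \<and>
      f = restrict (\<lambda>a. a) (c X) \<and> g = restrict (\<lambda>b. b) (d X))" for X Y f g
    using ext[of f "c X"] ext[of g "d X"] mor[of X Y] by blast
  then show ?thesis
    by (simp add: inclusion_cat_def)
qed

text \<open>
  The functors are in fact mutually inverse on objects, so identities serve as the natural
  isomorphisms.
\<close>

lemma inclusion_cats_equivalent:
  assumes F: "\<And>X. P X \<Longrightarrow> Q (F X)" and H: "\<And>Y. Q Y \<Longrightarrow> P (H Y)"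
    and HF: "\<And>X. P X \<Longrightarrow> H (F X) = X" and FH: "\<And>Y. Q Y \<Longrightarrow> F (H Y) = Y"
    and F_mono: "\<And>X X'. \<lbrakk>P X; P X'; c X \<subseteq> c X'; d X \<subseteq> d X'\<rbrakk>
      \<Longrightarrow> c' (F X) \<subseteq> c' (F X') \<and> d' (F X) \<subseteq> d' (F X')"
    and H_mono: "\<And>Y Y'. \<lbrakk>Q Y; Q Y'; c' Y \<subseteq> c' Y'; d' Y \<subseteq> d' Y'\<rbrakk>
      \<Longrightarrow> c (H Y) \<subseteq> c (H Y') \<and> d (H Y) \<subseteq> d (H Y')"
  shows "equivalent_categories (inclusion_cat P c d) (inclusion_cat Q c' d')"
proof -
  let ?C = "inclusion_cat P c d" and ?D = "inclusion_cat Q c' d'"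
  let ?Fa = "\<lambda>(X, f, g, X'). (F X, restrict (\<lambda>a. a) (c' (F X)), restrict (\<lambda>b. b) (d' (F X)), F X')"
  let ?Ha = "\<lambda>(Y, f, g, Y'). (H Y, restrict (\<lambda>a. a) (c (H Y)), restrict (\<lambda>b. b) (d (H Y)), H Y')"
  have "is_functor ?C ?D F ?Fa"
  proof unfold_locales
    show "?Fa f \<in> Arr ?D" if "f \<in> Arr ?C" for f
    proof -
      obtain X u v X' where "f = (X, u, v, X')" by (cases f)
      then show ?thesis
        using that F[of X] F[of X'] F_mono[of X X'] by (simp add: inclusion_cat_def)
    qed
  qed (auto simp: inclusion_cat_def F, auto simp: compose_def fun_eq_iff dest: F_mono)
  moreover have "is_functor ?D ?C H ?Ha"
  proof unfold_locales
    show "?Ha f \<in> Arr ?C" if "f \<in> Arr ?D" for f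
    proof -
      obtain X u v X' where "f = (X, u, v, X')" by (cases f)
      then show ?thesis
        using that H[of X] H[of X'] H_mono[of X X'] by (simp add: inclusion_cat_def)
    qed
  qed (auto simp: inclusion_cat_def H, auto simp: compose_def fun_eq_iff dest: H_mono)
  moreover have "natural_isomorphism ?C ?C (\<lambda>x. x) (\<lambda>f. f) (H \<circ> F) (?Ha \<circ> ?Fa) (Ident ?C)"
    by unfold_locales
      (use HF in \<open>auto simp: inclusion_cat_def compose_inclusions inverse_arrows_def\<close>)
  moreover have "natural_isomorphism ?D ?D (F \<circ> H) (?Fa \<circ> ?Ha) (\<lambda>x. x) (\<lambda>f. f) (Ident ?D)"
    by unfold_locales
      (use FH in \<open>auto simp: inclusion_cat_def compose_inclusions inverse_arrows_def\<close>)
  ultimately show ?thesis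
    using category_inclusion_cat[of P c d] category_inclusion_cat[of Q c' d']
    unfolding equivalent_categories_def by blast
qed


section \<open>Algebras, subobjects and ideals\<close>

locale opalgebra = groups_with_operations \<T>
  for \<T> :: "('u, 'w) optheory" +
  fixes A :: "('a, 'u, 'w) opalg" (structure)
  assumes object: "object \<T> A"
begin

lemma one_in [simp]: "\<one> \<in> carrier A"
  and neg_in: "a \<in> carrier A \<Longrightarrow> neg A a \<in> carrier A"
  and mult_in [simp]: "\<lbrakk>a \<in> carrier A; b \<in> carrier A\<rbrakk> \<Longrightarrow> a \<otimes> b \<in> carrier A"
  and un_in [simp]: "\<lbrakk>\<omega> \<in> Om1 \<T>; a \<in> carrier A\<rbrakk> \<Longrightarrow> un A \<omega> a \<in> carrier A"
  and bin_in [simp]: "\<lbrakk>\<sigma> \<in> Om2 \<T>; a \<in> carrier A; b \<in> carrier A\<rbrakk> \<Longrightarrow> bin A \<sigma> a b \<in> carrier A"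
  using object by (auto simp: object_def op_closed_def)

text \<open>
  The laws required of every theory have at most three variables, so an assignment that is
  constant from index two on captures all their instances.
\<close>

lemma identity:
  assumes "(l, r) \<in> Eqs \<T>" "a \<in> carrier A" "b \<in> carrier A" "c \<in> carrier A"
  shows "eval_term A (\<lambda>i. if i = 0 then a else if i = 1 then b else c) l =
    eval_term A (\<lambda>i. if i = 0 then a else if i = 1 then b else c) r"
proof -
  have "\<forall>(l, r)\<in>Eqs \<T>. \<forall>\<rho>. range \<rho> \<subseteq> carrier A \<longrightarrow> eval_term A \<rho> l = eval_term A \<rho> r"
    using object by (simp add: object_def)
  moreover have "range (\<lambda>i::nat. if i = 0 then a else if i = 1 then b else c) \<subseteq> carrier A"
    using assms by auto
  ultimately show ?thesis
    using assms(1) by blast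
qed

lemma group_A: "group A"
proof (rule groupI)
  fix x y z assume xyz: "x \<in> carrier A" "y \<in> carrier A" "z \<in> carrier A"
  show "x \<otimes> y \<otimes> z = x \<otimes> (y \<otimes> z)"
    using identity[of "Plus (Plus (Var 0) (Var 1)) (Var 2)"
        "Plus (Var 0) (Plus (Var 1) (Var 2))" x y z] xyz group_laws
    by (simp add: group_laws_def)
next
  fix x assume x: "x \<in> carrier A"
  show "\<one> \<otimes> x = x"
    using identity[of "Plus Zero (Var 0)" "Var 0" x x x] x group_laws
    by (simp add: group_laws_def)
  have "neg A x \<otimes> x = \<one>"
    using identity[of "Plus (Neg (Var 0)) (Var 0)" Zero x x x] x group_laws
    by (simp add: group_laws_def)
  then show "\<exists>y\<in>carrier A. y \<otimes> x = \<one>"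
    using neg_in x by blast
qed simp_all

sublocale group A
  by (fact group_A)

lemma neg_eq_inv [simp]: "a \<in> carrier A \<Longrightarrow> neg A a = inv a"
  using identity[of "Plus (Neg (Var 0)) (Var 0)" Zero a a a] group_laws neg_in
  by (intro inv_equality[symmetric]) (simp_all add: group_laws_def)

lemma inv_cancel_left [simp]:
  "\<lbrakk>a \<in> carrier A; b \<in> carrier A\<rbrakk> \<Longrightarrow> inv a \<otimes> (a \<otimes> b) = b"
  "\<lbrakk>a \<in> carrier A; b \<in> carrier A\<rbrakk> \<Longrightarrow> a \<otimes> (inv a \<otimes> b) = b"
  by (simp_all add: m_assoc[symmetric])

lemma un_mult:
  "\<lbrakk>\<omega> \<in> Om1 \<T>; a \<in> carrier A; b \<in> carrier A\<rbrakk> \<Longrightarrow> un A \<omega> (a \<otimes> b) = un A \<omega> a \<otimes> un A \<omega> b"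
  using identity[OF additive_law, of \<omega> a b b] by simp

lemma bin_opp: "\<lbrakk>\<sigma> \<in> Om2 \<T>; a \<in> carrier A; b \<in> carrier A\<rbrakk> \<Longrightarrow> bin A (opp \<T> \<sigma>) a b = bin A \<sigma> b a"
  using identity[OF opp_law, of \<sigma> a b b] by simp

lemma bin_mult_right:
  "\<lbrakk>\<sigma> \<in> Om2 \<T>; a \<in> carrier A; b \<in> carrier A; c \<in> carrier A\<rbrakk>
   \<Longrightarrow> bin A \<sigma> a (b \<otimes> c) = bin A \<sigma> a b \<otimes> bin A \<sigma> a c"
  using identity[OF distrib_law, of \<sigma> a b c] by simp

text \<open>Distributivity on the left is distributivity on the right for the opposite operation.\<close>

lemma bin_mult_left:
  assumes "\<sigma> \<in> Om2 \<T>" "a \<in> carrier A" "b \<in> carrier A" "c \<in> carrier A"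
  shows "bin A \<sigma> (a \<otimes> b) c = bin A \<sigma> a c \<otimes> bin A \<sigma> b c"
  using bin_mult_right[of "opp \<T> \<sigma>" c a b] assms by (simp add: bin_opp opp_closed)

lemma bin_one_right [simp]:
  assumes "\<sigma> \<in> Om2 \<T>" "a \<in> carrier A"
  shows "bin A \<sigma> a \<one> = \<one>"
  using bin_mult_right[of \<sigma> a \<one> \<one>] assms by simp

lemma bin_one_left [simp]:
  assumes "\<sigma> \<in> Om2 \<T>" "a \<in> carrier A"
  shows "bin A \<sigma> \<one> a = \<one>"
  using bin_mult_left[of \<sigma> \<one> \<one> a] assms by simp

lemma un_one [simp]:
  assumes "\<omega> \<in> Om1 \<T>"
  shows "un A \<omega> \<one> = \<one>"
  using un_mult[of \<omega> \<one> \<one>] assms by simp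

lemma subobject_subgroup:
  assumes "subobject \<T> S A"
  shows "subgroup S A"
proof (rule subgroupI)
  have S: "S \<subseteq> carrier A" "op_closed \<T> S A"
    using assms by (simp_all add: subobject_def)
  then show "S \<subseteq> carrier A" "S \<noteq> {}" "\<And>a b. \<lbrakk>a \<in> S; b \<in> S\<rbrakk> \<Longrightarrow> a \<otimes> b \<in> S"
    by (auto simp: op_closed_def)
  fix a assume a: "a \<in> S"
  then have "neg A a \<in> S" using S by (simp add: op_closed_def)
  then show "inv a \<in> S" using neg_eq_inv[of a] a S(1) by auto
qed

lemma op_idealI:
  assumes "N \<subseteq> carrier A" "\<one> \<in> N"
    and "\<And>n. n \<in> N \<Longrightarrow> inv n \<in> N"
    and "\<And>n n'. \<lbrakk>n \<in> N; n' \<in> N\<rbrakk> \<Longrightarrow> n \<otimes> n' \<in> N"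
    and "\<And>\<omega> n. \<lbrakk>\<omega> \<in> Om1 \<T>; n \<in> N\<rbrakk> \<Longrightarrow> un A \<omega> n \<in> N"
    and "\<And>a n. \<lbrakk>a \<in> carrier A; n \<in> N\<rbrakk> \<Longrightarrow> a \<otimes> n \<otimes> inv a \<in> N"
    and "\<And>\<sigma> a n. \<lbrakk>\<sigma> \<in> Om2 \<T>; a \<in> carrier A; n \<in> N\<rbrakk> \<Longrightarrow> bin A \<sigma> a n \<in> N"
  shows "op_ideal \<T> N A"
proof -
  have N: "subobject \<T> N A"
    unfolding subobject_def op_closed_def
  proof (intro conjI ballI)
    show "neg A a \<in> N" if "a \<in> N" for a
      using that assms(1,3) by (metis neg_eq_inv subsetD)
  qed (use assms in auto)
  moreover have "N \<lhd> A"
    using subobject_subgroup[OF N] assms(6) by (auto simp: normal_inv_iff)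
  ultimately show ?thesis
    using assms(7) by (simp add: op_ideal_def)
qed

text \<open>
  Since the operations are closed under taking opposites, the one-sided condition on an ideal is
  in fact two-sided.
\<close>

lemma op_idealD:
  assumes "op_ideal \<T> N A"
  shows "N \<subseteq> carrier A" "\<one> \<in> N"
    and "\<And>n. n \<in> N \<Longrightarrow> inv n \<in> N"
    and "\<And>n n'. \<lbrakk>n \<in> N; n' \<in> N\<rbrakk> \<Longrightarrow> n \<otimes> n' \<in> N"
    and "\<And>\<omega> n. \<lbrakk>\<omega> \<in> Om1 \<T>; n \<in> N\<rbrakk> \<Longrightarrow> un A \<omega> n \<in> N"
    and "\<And>a n. \<lbrakk>a \<in> carrier A; n \<in> N\<rbrakk> \<Longrightarrow> a \<otimes> n \<otimes> inv a \<in> N"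
    and "\<And>\<sigma> a n. \<lbrakk>\<sigma> \<in> Om2 \<T>; a \<in> carrier A; n \<in> N\<rbrakk> \<Longrightarrow> bin A \<sigma> a n \<in> N"
    and "\<And>\<sigma> a n. \<lbrakk>\<sigma> \<in> Om2 \<T>; a \<in> carrier A; n \<in> N\<rbrakk> \<Longrightarrow> bin A \<sigma> n a \<in> N"
proof -
  have N: "subobject \<T> N A" "N \<lhd> A"
    and N_bin: "\<And>\<sigma> a n. \<lbrakk>\<sigma> \<in> Om2 \<T>; a \<in> carrier A; n \<in> N\<rbrakk> \<Longrightarrow> bin A \<sigma> a n \<in> N"
    using assms by (auto simp: op_ideal_def)
  interpret N: subgroup N A by (rule subobject_subgroup[OF N(1)])
  show "N \<subseteq> carrier A" "\<one> \<in> N"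
    and "\<And>n. n \<in> N \<Longrightarrow> inv n \<in> N"
    and "\<And>n n'. \<lbrakk>n \<in> N; n' \<in> N\<rbrakk> \<Longrightarrow> n \<otimes> n' \<in> N"
    and "\<And>\<sigma> a n. \<lbrakk>\<sigma> \<in> Om2 \<T>; a \<in> carrier A; n \<in> N\<rbrakk> \<Longrightarrow> bin A \<sigma> a n \<in> N"
    by (simp_all add: N.subset N_bin)
  show "\<And>\<omega> n. \<lbrakk>\<omega> \<in> Om1 \<T>; n \<in> N\<rbrakk> \<Longrightarrow> un A \<omega> n \<in> N"
    using N(1) by (simp add: subobject_def op_closed_def)
  show "\<And>a n. \<lbrakk>a \<in> carrier A; n \<in> N\<rbrakk> \<Longrightarrow> a \<otimes> n \<otimes> inv a \<in> N"
    using N(2) by (simp add: normal_inv_iff)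
  show "\<And>\<sigma> a n. \<lbrakk>\<sigma> \<in> Om2 \<T>; a \<in> carrier A; n \<in> N\<rbrakk> \<Longrightarrow> bin A \<sigma> n a \<in> N"
    using N_bin opp_closed bin_opp by (metis N.mem_carrier)
qed

end

lemma morphism_preserves:
  assumes "groups_with_operations \<T>" "object \<T> A" "object \<T> B" "morphism \<T> A B f"
  shows "\<And>a. a \<in> carrier A \<Longrightarrow> f a \<in> carrier B"
    and "\<And>a b. \<lbrakk>a \<in> carrier A; b \<in> carrier A\<rbrakk> \<Longrightarrow> f (a \<otimes>\<^bsub>A\<^esub> b) = f a \<otimes>\<^bsub>B\<^esub> f b"
    and "f \<one>\<^bsub>A\<^esub> = \<one>\<^bsub>B\<^esub>"
    and "\<And>a. a \<in> carrier A \<Longrightarrow> f (inv\<^bsub>A\<^esub> a) = inv\<^bsub>B\<^esub> (f a)"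
    and "\<And>\<omega> a. \<lbrakk>\<omega> \<in> Om1 \<T>; a \<in> carrier A\<rbrakk> \<Longrightarrow> f (un A \<omega> a) = un B \<omega> (f a)"
    and "\<And>\<sigma> a b. \<lbrakk>\<sigma> \<in> Om2 \<T>; a \<in> carrier A; b \<in> carrier A\<rbrakk>
      \<Longrightarrow> f (bin A \<sigma> a b) = bin B \<sigma> (f a) (f b)"
proof -
  interpret A: opalgebra \<T> A using assms by (simp add: opalgebra_def opalgebra_axioms_def)
  interpret B: opalgebra \<T> B using assms by (simp add: opalgebra_def opalgebra_axioms_def)
  interpret group_hom A B f
    using assms(4) by unfold_locales (simp add: morphism_def)
  show "\<And>a. a \<in> carrier A \<Longrightarrow> f a \<in> carrier B"
    and "\<And>a b. \<lbrakk>a \<in> carrier A; b \<in> carrier A\<rbrakk> \<Longrightarrow> f (a \<otimes>\<^bsub>A\<^esub> b) = f a \<otimes>\<^bsub>B\<^esub> f b"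
    and "f \<one>\<^bsub>A\<^esub> = \<one>\<^bsub>B\<^esub>"
    and "\<And>a. a \<in> carrier A \<Longrightarrow> f (inv\<^bsub>A\<^esub> a) = inv\<^bsub>B\<^esub> (f a)"
    and "\<And>\<omega> a. \<lbrakk>\<omega> \<in> Om1 \<T>; a \<in> carrier A\<rbrakk> \<Longrightarrow> f (un A \<omega> a) = un B \<omega> (f a)"
    and "\<And>\<sigma> a b. \<lbrakk>\<sigma> \<in> Om2 \<T>; a \<in> carrier A; b \<in> carrier A\<rbrakk>
      \<Longrightarrow> f (bin A \<sigma> a b) = bin B \<sigma> (f a) (f b)"
    using assms(4) by (simp_all add: morphism_def)
qed

lemma object_restrict:
  assumes "object \<T> A" "subobject \<T> S A"
  shows "object \<T> (A\<lparr>carrier := S\<rparr>)"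
proof -
  have eval: "eval_term (A\<lparr>carrier := S\<rparr>) \<rho> t = eval_term A \<rho> t" for \<rho> t
    by (induction t) simp_all
  have "op_closed \<T> S A" "S \<subseteq> carrier A"
    using assms(2) by (simp_all add: subobject_def)
  moreover have "\<forall>(l, r)\<in>Eqs \<T>. \<forall>\<rho>. range \<rho> \<subseteq> carrier A \<longrightarrow> eval_term A \<rho> l = eval_term A \<rho> r"
    using assms(1) by (simp add: object_def)
  ultimately show ?thesis
    by (fastforce simp: object_def eval op_closed_def)
qed

lemma morphism_restrict:
  assumes "morphism \<T> A B f" "S \<subseteq> carrier A" "f ` S \<subseteq> T"
  shows "morphism \<T> (A\<lparr>carrier := S\<rparr>) (B\<lparr>carrier := T\<rparr>) f"
  using assms by (auto simp: morphism_def hom_def Pi_iff subset_iff)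

text \<open>
  Neither restriction changes an operation, so the only condition on an inclusion is that its
  values land in the target; closure of \<open>S\<close> lets the restricted map be evaluated on results of
  operations.
\<close>

lemma inclusion_morphism_iff:
  assumes "op_closed \<T> S A"
  shows "morphism \<T> (A\<lparr>carrier := S\<rparr>) (A\<lparr>carrier := T\<rparr>) (restrict (\<lambda>a. a) S) \<longleftrightarrow> S \<subseteq> T"
  using assms by (auto simp: morphism_def hom_def op_closed_def Pi_iff)

lemma morphism_compose:
  assumes "morphism \<T> A B f" "morphism \<T> B C g"
  shows "morphism \<T> A C (g \<circ> f)"
  using assms by (auto simp: morphism_def hom_def Pi_iff)

lemma op_ideal_preimage:
  assumes "groups_with_operations \<T>" "object \<T> A" "object \<T> B" "morphism \<T> A B f"
    and "op_ideal \<T> N B"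
  shows "op_ideal \<T> {a \<in> carrier A. f a \<in> N} A"
proof -
  interpret A: opalgebra \<T> A using assms by (simp add: opalgebra_def opalgebra_axioms_def)
  interpret B: opalgebra \<T> B using assms by (simp add: opalgebra_def opalgebra_axioms_def)
  show ?thesis
    by (rule A.op_idealI)
      (auto simp: morphism_preserves[OF assms(1-4)] B.op_idealD[OF assms(5)])
qed


section \<open>Derived actions from arbitrary split extensions\<close>

text \<open>
  The structure on the image of \<open>\<psi>\<close> that makes \<open>\<psi>\<close> an isomorphism, provided that \<open>\<psi>\<close> is injective
  on the carrier.
\<close>

definition transport :: "('a \<Rightarrow> 'b) \<Rightarrow> ('a, 'u, 'w) opalg \<Rightarrow> ('b, 'u, 'w) opalg" where
  "transport \<psi> E = (let \<phi> = inv_into (carrier E) \<psi> in \<lparr>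
     carrier = \<psi> ` carrier E,
     monoid.mult = (\<lambda>x y. \<psi> (\<phi> x \<otimes>\<^bsub>E\<^esub> \<phi> y)),
     one = \<psi> \<one>\<^bsub>E\<^esub>,
     neg = (\<lambda>x. \<psi> (neg E (\<phi> x))),
     un = (\<lambda>\<omega> x. \<psi> (un E \<omega> (\<phi> x))),
     bin = (\<lambda>\<sigma> x y. \<psi> (bin E \<sigma> (\<phi> x) (\<phi> y)))\<rparr>)"

lemma morphism_into_transport:
  assumes "inj_on \<psi> (carrier E)"
  shows "morphism \<T> E (transport \<psi> E) \<psi>"
  using assms by (auto simp: morphism_def hom_def transport_def Let_def)

lemma morphism_from_transport:
  assumes "object \<T> E" "inj_on \<psi> (carrier E)"
  shows "morphism \<T> (transport \<psi> E) E (inv_into (carrier E) \<psi>)"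
  using assms by (auto simp: morphism_def hom_def transport_def Let_def object_def op_closed_def)

text \<open>
  The second conjunct is carried along because the inverse of \<open>\<psi>\<close> cancels only on the carrier;
  well-formedness is what keeps the values of subterms there.
\<close>

lemma eval_transport:
  assumes E: "object \<T> E" and inj: "inj_on \<psi> (carrier E)"
    and \<rho>: "range \<rho> \<subseteq> \<psi> ` carrier E" and t: "wf_term \<T> t"
  shows "eval_term (transport \<psi> E) \<rho> t = \<psi> (eval_term E (inv_into (carrier E) \<psi> \<circ> \<rho>) t)
    \<and> eval_term E (inv_into (carrier E) \<psi> \<circ> \<rho>) t \<in> carrier E"
  using t
proof (induction t)
  case (Var i)
  have "\<rho> i \<in> \<psi> ` carrier E" using \<rho> by auto
  then show ?case using inj by (auto simp: f_inv_into_f inv_into_into)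
qed (use E inj in \<open>auto simp: transport_def Let_def object_def op_closed_def\<close>)

lemma object_transport:
  fixes \<psi> :: "'a \<Rightarrow> 'b"
  assumes "groups_with_operations \<T>" and E: "object \<T> E" and inj: "inj_on \<psi> (carrier E)"
  shows "object \<T> (transport \<psi> E)"
  unfolding object_def
proof (intro conjI ballI allI impI, safe)
  show "op_closed \<T> (carrier (transport \<psi> E)) (transport \<psi> E)"
    using E inj by (auto simp: transport_def Let_def object_def op_closed_def)
  fix l r and \<rho> :: "nat \<Rightarrow> 'b"
  assume lr: "(l, r) \<in> Eqs \<T>" and "range \<rho> \<subseteq> carrier (transport \<psi> E)"
  then have \<rho>: "range \<rho> \<subseteq> \<psi> ` carrier E" by (simp add: transport_def Let_def)
  have "range (inv_into (carrier E) \<psi> \<circ> \<rho>) \<subseteq> carrier E"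
    using \<rho> by (auto intro!: inv_into_into)
  then have "eval_term E (inv_into (carrier E) \<psi> \<circ> \<rho>) l = eval_term E (inv_into (carrier E) \<psi> \<circ> \<rho>) r"
    using E lr unfolding object_def by blast
  then show "eval_term (transport \<psi> E) \<rho> l = eval_term (transport \<psi> E) \<rho> r"
    using eval_transport[OF E inj \<rho>] groups_with_operations.Eqs_wf[OF assms(1) lr] by simp
qed

text \<open>
  An element \<open>e\<close> of a split extension is determined by its image \<open>p e\<close> and by the element
  \<open>e - s (p e)\<close> of the kernel. This injects the middle object, whatever its type, into the product
  type on which derived actions are defined.
\<close>

lemma derived_actionI:
  fixes E :: "('e, 'u, 'w) opalg" and A :: "('a, 'u, 'w) opalg" and B :: "('b, 'u, 'w) opalg"
    and dot :: "'b \<Rightarrow> 'a \<Rightarrow> 'a" and act :: "'w \<Rightarrow> 'b \<Rightarrow> 'a \<Rightarrow> 'a"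
  assumes \<T>: "groups_with_operations \<T>" and B: "object \<T> B" and E: "object \<T> E"
    and i: "morphism \<T> A E i" and p: "morphism \<T> E B p" and s: "morphism \<T> B E s"
    and inj_i: "inj_on i (carrier A)" and exact: "i ` carrier A = kernel E B p"
    and split: "\<And>b. b \<in> carrier B \<Longrightarrow> p (s b) = b"
    and dot: "\<And>b a. \<lbrakk>b \<in> carrier B; a \<in> carrier A\<rbrakk> \<Longrightarrow>
      dot b a \<in> carrier A \<and> i (dot b a) = s b \<otimes>\<^bsub>E\<^esub> i a \<otimes>\<^bsub>E\<^esub> neg E (s b)"
    and act: "\<And>\<sigma> b a. \<lbrakk>\<sigma> \<in> Om2 \<T>; b \<in> carrier B; a \<in> carrier A\<rbrakk> \<Longrightarrow>
      act \<sigma> b a \<in> carrier A \<and> i (act \<sigma> b a) = bin E \<sigma> (s b) (i a)"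
  shows "derived_action \<T> B A dot act"
proof -
  interpret E: opalgebra \<T> E using \<T> E by (simp add: opalgebra_def opalgebra_axioms_def)
  interpret B: opalgebra \<T> B using \<T> B by (simp add: opalgebra_def opalgebra_axioms_def)
  note p_simps = morphism_preserves[OF \<T> E B p] and s_simps = morphism_preserves[OF \<T> B E s]
  define \<psi> where "\<psi> e = (inv_into (carrier A) i (e \<otimes>\<^bsub>E\<^esub> inv\<^bsub>E\<^esub> (s (p e))), p e)" for e
  have inj: "inj_on \<psi> (carrier E)"
  proof (rule inj_onI)
    fix e e' assume e: "e \<in> carrier E" "e' \<in> carrier E" and eq: "\<psi> e = \<psi> e'"
    have ker: "x \<otimes>\<^bsub>E\<^esub> inv\<^bsub>E\<^esub> (s (p x)) \<in> i ` carrier A" if "x \<in> carrier E" for x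
      using that by (simp add: exact kernel_def p_simps s_simps split)
    have "p e = p e'" using eq by (simp add: \<psi>_def)
    moreover from this have "e \<otimes>\<^bsub>E\<^esub> inv\<^bsub>E\<^esub> (s (p e)) = e' \<otimes>\<^bsub>E\<^esub> inv\<^bsub>E\<^esub> (s (p e))"
      using eq ker[OF e(1)] ker[OF e(2)] by (auto simp: \<psi>_def dest: inv_into_injective)
    ultimately show "e = e'"
      using e p_simps(1) s_simps(1) by (metis E.inv_closed E.right_cancel)
  qed
  let ?E = "transport \<psi> E" and ?\<phi> = "inv_into (carrier E) \<psi>"
  have \<phi>\<psi>: "?\<phi> (\<psi> e) = e" if "e \<in> carrier E" for e
    using that inj by simp
  have i_in: "i a \<in> carrier E" if "a \<in> carrier A" for a
    using that i by (auto simp: morphism_def hom_def)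
  note transport_simps = transport_def Let_def
  show ?thesis
    unfolding derived_action_def
  proof (intro exI conjI ballI)
    show "object \<T> ?E" by (rule object_transport[OF \<T> E inj])
    show "morphism \<T> A ?E (\<psi> \<circ> i)" "morphism \<T> B ?E (\<psi> \<circ> s)"
      using i s morphism_into_transport[OF inj] by (blast intro: morphism_compose)+
    show "morphism \<T> ?E B (p \<circ> ?\<phi>)"
      by (rule morphism_compose[OF morphism_from_transport[OF E inj] p])
    show "inj_on (\<psi> \<circ> i) (carrier A)"
      using inj_i i_in by (intro comp_inj_on inj_on_subset[OF inj]) auto
    have "kernel ?E B (p \<circ> ?\<phi>) = \<psi> ` kernel E B p"
      using \<phi>\<psi> by (auto simp: kernel_def transport_simps)
    then show "(\<psi> \<circ> i) ` carrier A = kernel ?E B (p \<circ> ?\<phi>)"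
      by (simp only: image_comp[symmetric] exact)
    show "(p \<circ> ?\<phi>) ` carrier ?E = carrier B"
    proof
      show "(p \<circ> ?\<phi>) ` carrier ?E \<subseteq> carrier B"
        using \<phi>\<psi> p_simps(1) by (auto simp: transport_simps)
      show "carrier B \<subseteq> (p \<circ> ?\<phi>) ` carrier ?E"
      proof
        fix b assume b: "b \<in> carrier B"
        then have "b = (p \<circ> ?\<phi>) (\<psi> (s b))" using \<phi>\<psi> s_simps(1) split by simp
        then show "b \<in> (p \<circ> ?\<phi>) ` carrier ?E"
          using b s_simps(1) by (auto simp: transport_simps)
      qed
    qed
    show "(p \<circ> ?\<phi>) ((\<psi> \<circ> s) b) = b" if "b \<in> carrier B" for b
      using that \<phi>\<psi> s_simps(1) split by simp
    show "dot b a \<in> carrier A" if "b \<in> carrier B" "a \<in> carrier A" for b a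
      using that dot by blast
    show "(\<psi> \<circ> i) (dot b a) = (\<psi> \<circ> s) b \<otimes>\<^bsub>?E\<^esub> (\<psi> \<circ> i) a \<otimes>\<^bsub>?E\<^esub> neg ?E ((\<psi> \<circ> s) b)"
      if "b \<in> carrier B" "a \<in> carrier A" for b a
      using that dot \<phi>\<psi> i_in s_simps(1) by (simp add: transport_simps)
    show "act \<sigma> b a \<in> carrier A" if "\<sigma> \<in> Om2 \<T>" "b \<in> carrier B" "a \<in> carrier A" for \<sigma> b a
      using that act by blast
    show "(\<psi> \<circ> i) (act \<sigma> b a) = bin ?E \<sigma> ((\<psi> \<circ> s) b) ((\<psi> \<circ> i) a)"
      if "\<sigma> \<in> Om2 \<T>" "b \<in> carrier B" "a \<in> carrier A" for \<sigma> b a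
      using that act \<phi>\<psi> i_in s_simps(1) by (simp add: transport_simps)
  qed
qed


section \<open>The calculus of an internal groupoid\<close>

locale internal_groupoid_algebra = groups_with_operations \<T> + internal_groupoid \<T> G
  for \<T> :: "('u, 'w) optheory" and G :: "('o, 'm, 'u, 'w) igpd"
begin

sublocale arrs: opalgebra \<T> "arrs G"
  by unfold_locales (fact arrs_object)

sublocale objs: opalgebra \<T> "objs G"
  by unfold_locales (fact objs_object)

abbreviation plus_arr (infixl "\<oplus>" 65) where "a \<oplus> b \<equiv> a \<otimes>\<^bsub>arrs G\<^esub> b"
abbreviation minus_arr (infixl "\<ominus>" 65) where "a \<ominus> b \<equiv> a \<oplus> inv\<^bsub>arrs G\<^esub> b"
abbreviation zero_arr ("\<zero>") where "\<zero> \<equiv> \<one>\<^bsub>arrs G\<^esub>"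
abbreviation star_kernel ("K") where "K \<equiv> kernel (arrs G) (objs G) (src G)"

text \<open>
  The fourth rule for identities, which moves inverses inside, is switched off wherever an identity
  has to cancel against its inverse among other arrows.
\<close>

lemmas src_simps [simp] = morphism_preserves[OF groups_with_operations_axioms arrs_object objs_object src_morphism]
lemmas tgt_simps [simp] = morphism_preserves[OF groups_with_operations_axioms arrs_object objs_object tgt_morphism]
lemmas idt_simps [simp] = morphism_preserves[OF groups_with_operations_axioms objs_object arrs_object idt_morphism]

lemma src_idt [simp]: "x \<in> carrier (objs G) \<Longrightarrow> src G (idt G x) = x"
  and tgt_idt [simp]: "x \<in> carrier (objs G) \<Longrightarrow> tgt G (idt G x) = x"
  and cmp_idt_src [simp]: "a \<in> carrier (arrs G) \<Longrightarrow> cmp G a (idt G (src G a)) = a"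
  and cmp_idt_tgt [simp]: "a \<in> carrier (arrs G) \<Longrightarrow> cmp G (idt G (tgt G a)) a = a"
proof -
  interpret C: category "underlying_cat G"
    using groupoid by (simp add: groupoid_def)
  show "x \<in> carrier (objs G) \<Longrightarrow> src G (idt G x) = x"
    and "x \<in> carrier (objs G) \<Longrightarrow> tgt G (idt G x) = x"
    and "a \<in> carrier (arrs G) \<Longrightarrow> cmp G a (idt G (src G a)) = a"
    and "a \<in> carrier (arrs G) \<Longrightarrow> cmp G (idt G (tgt G a)) a = a"
    using C.Dom_Ident[of x] C.Cod_Ident[of x] C.Cmp_Ident_right[of a] C.Cmp_Ident_left[of a]
    by (simp_all add: underlying_cat_def)
qed

text \<open>The interchange laws: composition is a morphism on the pullback of source and target.\<close>

lemma cmp_plus: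
  assumes "b \<in> carrier (arrs G)" "a \<in> carrier (arrs G)" "src G b = tgt G a"
    and "b' \<in> carrier (arrs G)" "a' \<in> carrier (arrs G)" "src G b' = tgt G a'"
  shows "cmp G (b \<oplus> b') (a \<oplus> a') = cmp G b a \<oplus> cmp G b' a'"
  using cmp_morphism assms by (auto simp: morphism_def hom_def composable_pairs_def)

lemma cmp_bin:
  assumes "\<sigma> \<in> Om2 \<T>"
    and "b \<in> carrier (arrs G)" "a \<in> carrier (arrs G)" "src G b = tgt G a"
    and "b' \<in> carrier (arrs G)" "a' \<in> carrier (arrs G)" "src G b' = tgt G a'"
  shows "cmp G (bin (arrs G) \<sigma> b b') (bin (arrs G) \<sigma> a a') =
    bin (arrs G) \<sigma> (cmp G b a) (cmp G b' a')"
  using cmp_morphism assms by (auto simp: morphism_def composable_pairs_def)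

lemma cmp_zero_right:
  assumes "a \<in> carrier (arrs G)" "src G a = \<one>\<^bsub>objs G\<^esub>"
  shows "cmp G a \<zero> = a"
  using cmp_idt_src[of a] assms by simp

lemma cmp_zero_left:
  assumes "a \<in> carrier (arrs G)" "tgt G a = \<one>\<^bsub>objs G\<^esub>"
  shows "cmp G \<zero> a = a"
  using cmp_idt_tgt[of a] assms by simp

text \<open>
  With \<open>y\<close> the middle object, \<open>(b, a) = (b - 1\<^sub>y, 0) + (1\<^sub>y, a)\<close> in the pullback, and both
  summands compose trivially.
\<close>

lemma cmp_eq:
  assumes "b \<in> carrier (arrs G)" "a \<in> carrier (arrs G)" "src G b = tgt G a"
  shows "cmp G b a = b \<ominus> idt G (tgt G a) \<oplus> a"
proof -
  let ?y = "idt G (tgt G a)"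
  have "cmp G (b \<ominus> ?y \<oplus> ?y) (\<zero> \<oplus> a) = cmp G (b \<ominus> ?y) \<zero> \<oplus> cmp G ?y a"
    by (rule cmp_plus) (use assms in simp_all)
  then show ?thesis
    using assms by (simp add: cmp_zero_right arrs.m_assoc)
qed

text \<open>
  For \<open>u\<close> starting and \<open>v\<close> ending at \<open>0\<close>, the pair \<open>(u, v)\<close> is \<open>(u, 0) + (0, v)\<close> and also
  \<open>(0, v) + (u, 0)\<close>; applying composition to both shows that \<open>u\<close> and \<open>v\<close> commute.
\<close>

lemma kernels_commute:
  assumes "u \<in> carrier (arrs G)" "src G u = \<one>\<^bsub>objs G\<^esub>"
    and "v \<in> carrier (arrs G)" "tgt G v = \<one>\<^bsub>objs G\<^esub>"
  shows "u \<oplus> v = v \<oplus> u"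
proof -
  have "cmp G (u \<oplus> \<zero>) (\<zero> \<oplus> v) = u \<oplus> v"
    using cmp_plus[of u \<zero> \<zero> v] assms by (simp add: cmp_zero_left cmp_zero_right)
  moreover have "cmp G (\<zero> \<oplus> u) (v \<oplus> \<zero>) = v \<oplus> u"
    using cmp_plus[of \<zero> v u \<zero>] assms by (simp add: cmp_zero_left cmp_zero_right)
  ultimately show ?thesis using assms by simp
qed

lemma kernels_annihilate:
  assumes "\<sigma> \<in> Om2 \<T>" "u \<in> carrier (arrs G)" "src G u = \<one>\<^bsub>objs G\<^esub>"
    and "v \<in> carrier (arrs G)" "tgt G v = \<one>\<^bsub>objs G\<^esub>"
  shows "bin (arrs G) \<sigma> v u = \<zero>"
  using cmp_bin[of \<sigma> \<zero> v u \<zero>] assms by (simp add: cmp_zero_left cmp_zero_right)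

lemma K_iff: "a \<in> K \<longleftrightarrow> a \<in> carrier (arrs G) \<and> src G a = \<one>\<^bsub>objs G\<^esub>"
  by (simp add: kernel_def)

text \<open>
  The Peiffer identities: \<open>a\<close> and the identity at its target differ by an element of the kernel
  of the target map, and such elements act trivially on \<open>K\<close>.
\<close>

lemma peiffer_plus:
  assumes "a \<in> K" "a' \<in> K"
  shows "idt G (tgt G a) \<oplus> a' \<ominus> idt G (tgt G a) = a \<oplus> a' \<ominus> a"
proof -
  let ?e = "idt G (tgt G a)"
  have in_arrs: "a \<in> carrier (arrs G)" "a' \<in> carrier (arrs G)" "?e \<in> carrier (arrs G)"
    and "src G a' = \<one>\<^bsub>objs G\<^esub>"
    using assms by (simp_all add: K_iff)
  \<comment> \<open>\<open>- 1\<^sub>y + a\<close>, for \<open>y\<close> the target of \<open>a\<close>, ends at \<open>0\<close>.\<close>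
  then have "a' \<oplus> (inv\<^bsub>arrs G\<^esub> ?e \<oplus> a) = inv\<^bsub>arrs G\<^esub> ?e \<oplus> a \<oplus> a'"
    by (intro kernels_commute) (simp_all del: idt_simps(4))
  then have "?e \<oplus> (a' \<oplus> (inv\<^bsub>arrs G\<^esub> ?e \<oplus> a)) \<ominus> a = ?e \<oplus> (inv\<^bsub>arrs G\<^esub> ?e \<oplus> a \<oplus> a') \<ominus> a"
    by (simp only:)
  then show ?thesis
    using in_arrs by (simp add: arrs.m_assoc del: idt_simps)
qed

lemma peiffer_bin:
  assumes "\<sigma> \<in> Om2 \<T>" "a \<in> K" "a' \<in> K"
  shows "bin (arrs G) \<sigma> (idt G (tgt G a)) a' = bin (arrs G) \<sigma> a a'"
proof -
  let ?e = "idt G (tgt G a)"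
  have in_arrs: "a \<in> carrier (arrs G)" "a' \<in> carrier (arrs G)" "?e \<in> carrier (arrs G)"
    and "src G a' = \<one>\<^bsub>objs G\<^esub>"
    using assms by (simp_all add: K_iff)
  then have "bin (arrs G) \<sigma> (a \<ominus> ?e) a' = \<zero>"
    using assms(1) by (intro kernels_annihilate) (simp_all del: idt_simps(4))
  moreover have "bin (arrs G) \<sigma> (a \<ominus> ?e \<oplus> ?e) a' =
      bin (arrs G) \<sigma> (a \<ominus> ?e) a' \<oplus> bin (arrs G) \<sigma> ?e a'"
    using assms(1) in_arrs by (intro arrs.bin_mult_left) auto
  ultimately show ?thesis
    using assms(1) in_arrs by (simp add: arrs.m_assoc del: idt_simps)
qed

end


section \<open>From normal subgroupoids to normal subcrossed modules\<close>

context internal_groupoid_algebra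
begin

abbreviation "X \<equiv> xmod_of_igpd G"

lemma xmod_simps [simp]:
  "fibre X = (arrs G)\<lparr>carrier := K\<rparr>" "base X = objs G" "bdry X = tgt G"
  "act X \<sigma> b a = bin (arrs G) \<sigma> (idt G b) a"
  by (simp_all add: xmod_of_igpd_def)

lemma dot_eq [simp]:
  "b \<in> carrier (objs G) \<Longrightarrow> dot X b a = idt G b \<oplus> a \<ominus> idt G b"
  by (simp add: xmod_of_igpd_def)

lemma restrict_xmod_simps [simp]:
  "fibre (restrict_xmod Y S T) = (fibre Y)\<lparr>carrier := S\<rparr>"
  "base (restrict_xmod Y S T) = (base Y)\<lparr>carrier := T\<rparr>"
  "bdry (restrict_xmod Y S T) = bdry Y"
  "dot (restrict_xmod Y S T) = dot Y"
  "act (restrict_xmod Y S T) = act Y"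
  by (simp_all add: restrict_xmod_def)

lemma restrict_igpd_simps [simp]:
  "arrs (restrict_igpd H S T) = (arrs H)\<lparr>carrier := S\<rparr>"
  "objs (restrict_igpd H S T) = (objs H)\<lparr>carrier := T\<rparr>"
  by (simp_all add: restrict_igpd_def)

text \<open>
  A normal subgroupoid is determined by its ideal of arrows: an object belongs to it exactly when
  its identity does.
\<close>

lemma normal_subgroupoid_ideal:
  assumes "internal_normal_subgroupoid \<T> N G"
  shows "N = restrict_igpd G (carrier (arrs N)) (carrier (objs N))"
    and "op_ideal \<T> (carrier (arrs N)) (arrs G)"
    and "carrier (objs N) = {x \<in> carrier (objs G). idt G x \<in> carrier (arrs N)}"
    and "\<And>a. a \<in> carrier (arrs N) \<Longrightarrow> src G a \<in> carrier (objs N)"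
    and "\<And>a. a \<in> carrier (arrs N) \<Longrightarrow> tgt G a \<in> carrier (objs N)"
    and "\<And>a b. \<lbrakk>a \<in> carrier (arrs N); b \<in> carrier (arrs N); src G b = tgt G a\<rbrakk>
      \<Longrightarrow> cmp G b a \<in> carrier (arrs N)"
proof -
  obtain N1 N0 where N: "N = restrict_igpd G N1 N0" "N1 \<subseteq> carrier (arrs G)" "N0 \<subseteq> carrier (objs G)"
    and ends: "\<And>a. a \<in> N1 \<Longrightarrow> src G a \<in> N0" "\<And>a. a \<in> N1 \<Longrightarrow> tgt G a \<in> N0"
    and idts: "\<And>x. x \<in> N0 \<Longrightarrow> idt G x \<in> N1"
    using assms unfolding internal_normal_subgroupoid_def subgroupoid_def by blast
  have carriers: "carrier (arrs N) = N1" "carrier (objs N) = N0"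
    using N(1) by simp_all
  show "N = restrict_igpd G (carrier (arrs N)) (carrier (objs N))"
    using N(1) carriers by simp
  show "op_ideal \<T> (carrier (arrs N)) (arrs G)"
    using assms by (simp add: internal_normal_subgroupoid_def)
  have "x \<in> N0" if "x \<in> carrier (objs G)" "idt G x \<in> N1" for x
    using ends(1)[OF that(2)] that(1) by simp
  then show "carrier (objs N) = {x \<in> carrier (objs G). idt G x \<in> carrier (arrs N)}"
    using N(3) idts carriers by auto
qed (use assms in \<open>auto simp: internal_normal_subgroupoid_def subgroupoid_def\<close>)

lemma objects_ideal:
  assumes "op_ideal \<T> N1 (arrs G)"
  shows "op_ideal \<T> {x \<in> carrier (objs G). idt G x \<in> N1} (objs G)"
  by (rule op_ideal_preimage[OF groups_with_operations_axioms objs_object arrs_object idt_morphism assms])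

lemma subobject_K: "subobject \<T> K (arrs G)"
  by (auto simp: subobject_def op_closed_def K_iff)

text \<open>
  The actions are given by identity arrows, so each closure condition combines an ideal condition
  on \<open>N\<^sub>1\<close> with a computation of the source. The split extension behind the action is
  \<open>N\<^sub>1 \<inter> K \<rightarrow> N\<^sub>1 \<rightarrow> N\<^sub>0\<close>, with projection the source map and section \<open>x \<mapsto> 1\<^sub>x\<close>.
\<close>

lemma normal_subcrossed_module_of_ideal:
  assumes N1: "op_ideal \<T> N1 (arrs G)" and N0: "N0 = {x \<in> carrier (objs G). idt G x \<in> N1}"
    and ends: "\<And>a. a \<in> N1 \<Longrightarrow> src G a \<in> N0" "\<And>a. a \<in> N1 \<Longrightarrow> tgt G a \<in> N0"
  shows "normal_subcrossed_module \<T> (restrict_xmod X (N1 \<inter> K) N0) X"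
proof -
  note N1_rules = arrs.op_idealD[OF N1]
  have N0_ideal: "op_ideal \<T> N0 (objs G)"
    using objects_ideal[OF N1] N0 by simp
  have N0_objs: "x \<in> carrier (objs G)" and N0_idt: "idt G x \<in> N1" if "x \<in> N0" for x
    using that N0 by auto
  have N1_arrs: "a \<in> carrier (arrs G)" if "a \<in> N1" for a
    using that N1_rules(1) by blast
  have S: "subobject \<T> (N1 \<inter> K) (arrs G)"
    using N1 subobject_K by (auto simp: op_ideal_def subobject_def op_closed_def)
  have N1_sub: "subobject \<T> N1 (arrs G)" and N0_sub: "subobject \<T> N0 (objs G)"
    using N1 N0_ideal by (simp_all add: op_ideal_def)
  have dot_in: "idt G b \<oplus> s \<ominus> idt G b \<in> N1 \<inter> K"
    if "b \<in> carrier (objs G)" "s \<in> N1 \<inter> K" for b s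
    using that N1_rules(6)[of "idt G b" s] by (simp add: K_iff del: idt_simps(4))
  have act_in: "bin (arrs G) \<sigma> (idt G b) s \<in> N1 \<inter> K"
    if "\<sigma> \<in> Om2 \<T>" "b \<in> carrier (objs G)" "s \<in> N1 \<inter> K" for \<sigma> b s
    using that N1_rules(7)[of \<sigma> "idt G b" s] by (simp add: K_iff)
  have dot_diff_in: "idt G t \<oplus> a \<ominus> idt G t \<ominus> a \<in> N1 \<inter> K" if "t \<in> N0" "a \<in> K" for t a
  proof -
    have "idt G t \<oplus> (a \<oplus> inv\<^bsub>arrs G\<^esub> (idt G t) \<ominus> a) \<in> N1"
      using that N0_idt N1_rules by (intro N1_rules(4) N1_rules(6)) (auto simp: K_iff simp del: idt_simps(4))
    then show ?thesis
      using that N0_objs by (simp add: K_iff arrs.m_assoc del: idt_simps(4))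
  qed
  have act_t_in: "bin (arrs G) \<sigma> (idt G t) a \<in> N1 \<inter> K"
    if "\<sigma> \<in> Om2 \<T>" "t \<in> N0" "a \<in> K" for \<sigma> t a
    using that N1_rules(8)[of \<sigma> a "idt G t"] N0_objs N0_idt by (simp add: K_iff)
  have S_obj: "object \<T> (arrs G\<lparr>carrier := N1 \<inter> K\<rparr>)"
    by (rule object_restrict[OF arrs_object S])
  have N0_obj: "object \<T> (objs G\<lparr>carrier := N0\<rparr>)"
    by (rule object_restrict[OF objs_object N0_sub])
  have action: "derived_action \<T> (objs G\<lparr>carrier := N0\<rparr>) (arrs G\<lparr>carrier := N1 \<inter> K\<rparr>) (dot X) (act X)"
  proof (rule derived_actionI)
    show "groups_with_operations \<T>" by (fact groups_with_operations_axioms)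
    show "object \<T> (arrs G\<lparr>carrier := N1\<rparr>)"
      by (rule object_restrict[OF arrs_object N1_sub])
    show "morphism \<T> (arrs G\<lparr>carrier := N1 \<inter> K\<rparr>) (arrs G\<lparr>carrier := N1\<rparr>) (\<lambda>a. a)"
      by (auto simp: morphism_def hom_def)
    show "morphism \<T> (arrs G\<lparr>carrier := N1\<rparr>) (objs G\<lparr>carrier := N0\<rparr>) (src G)"
      using morphism_restrict[OF src_morphism N1_rules(1)] ends(1) by blast
    show "morphism \<T> (objs G\<lparr>carrier := N0\<rparr>) (arrs G\<lparr>carrier := N1\<rparr>) (idt G)"
      using morphism_restrict[OF idt_morphism] N0_objs N0_idt by blast
  qed (use dot_in act_in N0_objs N1_arrs in \<open>auto simp: N0_obj kernel_def\<close>)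
  have "morphism \<T> (arrs G\<lparr>carrier := N1 \<inter> K\<rparr>) (objs G\<lparr>carrier := N0\<rparr>) (tgt G)"
    using morphism_restrict[OF tgt_morphism, of "N1 \<inter> K" N0] ends(2) N1_arrs by blast
  then have "crossed_module \<T> (restrict_xmod X (N1 \<inter> K) N0)"
    using S_obj N0_obj action N0_objs ends(2)
    by (intro crossed_module.intro)
      (auto simp: K_iff peiffer_plus peiffer_bin objs.bin_opp opp_closed)
  moreover have "subobject \<T> (N1 \<inter> K) (arrs G\<lparr>carrier := K\<rparr>)"
    using S by (auto simp: subobject_def op_closed_def)
  ultimately show ?thesis
    using N0_ideal N0_sub N0_objs dot_in act_in dot_diff_in act_t_in
    unfolding normal_subcrossed_module_def subcrossed_module_def by (auto simp: K_iff)
qed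

end


section \<open>From normal subcrossed modules to normal subgroupoids\<close>

context internal_groupoid_algebra
begin

text \<open>
  For \<open>S \<subseteq> K\<close> this is \<open>S + 1\<^sub>T\<close>, described by the decomposition of an arrow into a part in \<open>K\<close> and
  the identity at its source.
\<close>

definition arrows_over :: "'m set \<Rightarrow> 'o set \<Rightarrow> 'm set" where
  "arrows_over S T = {a \<in> carrier (arrs G). a \<ominus> idt G (src G a) \<in> S \<and> src G a \<in> T}"

lemma arrows_over_iff:
  assumes "S \<subseteq> K" "T \<subseteq> carrier (objs G)"
  shows "a \<in> arrows_over S T \<longleftrightarrow> (\<exists>s\<in>S. \<exists>t\<in>T. a = s \<oplus> idt G t)"
proof
  assume a: "a \<in> arrows_over S T"
  then have "a = (a \<ominus> idt G (src G a)) \<oplus> idt G (src G a)"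
    by (simp add: arrows_over_def arrs.m_assoc del: idt_simps(4))
  then show "\<exists>s\<in>S. \<exists>t\<in>T. a = s \<oplus> idt G t"
    using a unfolding arrows_over_def by blast
next
  assume "\<exists>s\<in>S. \<exists>t\<in>T. a = s \<oplus> idt G t"
  then obtain s t where st: "s \<in> S" "t \<in> T" "a = s \<oplus> idt G t" by blast
  then have "s \<in> K" "t \<in> carrier (objs G)" using assms by auto
  then show "a \<in> arrows_over S T"
    using st by (simp add: arrows_over_def K_iff arrs.m_assoc del: idt_simps(4))
qed

end

text \<open>
  What it says about \<open>S\<close> and \<open>T\<close> to be the carriers of a normal subcrossed module, with the actions
  expressed by the operations on arrows.
\<close>

locale normal_pair = internal_groupoid_algebra \<T> G
  for \<T> :: "('u, 'w) optheory" and G :: "('o, 'm, 'u, 'w) igpd" +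
  fixes S :: "'m set" and T :: "'o set"
  assumes S_K: "S \<subseteq> K" and S: "subobject \<T> S (arrs G)" and T: "op_ideal \<T> T (objs G)"
    and bdry_S: "s \<in> S \<Longrightarrow> tgt G s \<in> T"
    and dot_S: "\<lbrakk>b \<in> carrier (objs G); s \<in> S\<rbrakk> \<Longrightarrow> idt G b \<oplus> s \<ominus> idt G b \<in> S"
    and dot_T: "\<lbrakk>t \<in> T; a \<in> K\<rbrakk> \<Longrightarrow> idt G t \<oplus> a \<ominus> idt G t \<ominus> a \<in> S"
    and act_S: "\<lbrakk>\<sigma> \<in> Om2 \<T>; b \<in> carrier (objs G); s \<in> S\<rbrakk>
      \<Longrightarrow> bin (arrs G) \<sigma> (idt G b) s \<in> S"
    and act_T: "\<lbrakk>\<sigma> \<in> Om2 \<T>; t \<in> T; a \<in> K\<rbrakk> \<Longrightarrow> bin (arrs G) \<sigma> (idt G t) a \<in> S"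
begin

text \<open>
  Conjugation and the binary operations are checked separately against the two summands of an
  arbitrary arrow \<open>u + 1\<^sub>b\<close>: stability under the action of \<open>b\<close> deals with \<open>1\<^sub>b\<close>, while for \<open>u \<in> K\<close> the
  Peiffer identities replace \<open>u\<close> by its target on \<open>S\<close>, and the conditions on the action of \<open>T\<close>
  on \<open>K\<close> take care of \<open>1\<^sub>T\<close>.
\<close>

lemma op_ideal_arrows_over: "op_ideal \<T> (arrows_over S T) (arrs G)"
proof -
  note T_rules = objs.op_idealD[OF T]
  interpret S: subgroup S "arrs G" by (rule arrs.subobject_subgroup[OF S])
  note iff = arrows_over_iff[OF S_K T_rules(1)]
  have T_objs [simp]: "t \<in> carrier (objs G)" if "t \<in> T" for t
    using that T_rules(1) by blast
  have S_K' [simp]: "s \<in> K" if "s \<in> S" for s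
    using that S_K by blast
  have conj_base: "idt G b \<oplus> n \<ominus> idt G b \<in> arrows_over S T"
    if b: "b \<in> carrier (objs G)" and n: "n \<in> arrows_over S T" for b n
  proof -
    obtain s t where st: "s \<in> S" "t \<in> T" "n = s \<oplus> idt G t" using n iff by blast
    have "idt G b \<oplus> n \<ominus> idt G b = (idt G b \<oplus> s \<ominus> idt G b) \<oplus> (idt G b \<oplus> idt G t \<ominus> idt G b)"
      using st b by (simp add: arrs.m_assoc del: idt_simps(2,4))
    also have "\<dots> = (idt G b \<oplus> s \<ominus> idt G b) \<oplus> idt G (b \<otimes>\<^bsub>objs G\<^esub> t \<otimes>\<^bsub>objs G\<^esub> inv\<^bsub>objs G\<^esub> b)"
      using st b by simp
    finally show ?thesis
      using iff dot_S[OF b st(1)] T_rules(6)[OF b st(2)] by blast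
  qed
  have conj_fibre: "u \<oplus> n \<ominus> u \<in> arrows_over S T" if u: "u \<in> K" and n: "n \<in> arrows_over S T" for u n
  proof -
    obtain s t where st: "s \<in> S" "t \<in> T" "n = s \<oplus> idt G t" using n iff by blast
    have u_arrs: "u \<in> carrier (arrs G)" using u by (simp add: K_iff)
    have conj_s: "u \<oplus> s \<ominus> u \<in> S"
      using dot_S[of "tgt G u" s] peiffer_plus[OF u, of s] st u_arrs by simp
    have comm: "inv\<^bsub>arrs G\<^esub> (idt G t \<oplus> u \<ominus> idt G t \<ominus> u) \<in> S"
      using dot_T[OF st(2) u] by simp
    \<comment> \<open>\<open>u + s + 1\<^sub>t - u\<close> is \<open>u + s - u\<close> plus the commutator of \<open>u\<close> and \<open>1\<^sub>t\<close>, plus \<open>1\<^sub>t\<close>.\<close>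
    have "u \<oplus> n \<ominus> u =
        (u \<oplus> s \<ominus> u) \<oplus> inv\<^bsub>arrs G\<^esub> (idt G t \<oplus> u \<ominus> idt G t \<ominus> u) \<oplus> idt G t"
      using st u_arrs by (simp add: arrs.m_assoc arrs.inv_mult_group del: idt_simps(2,4))
    then show ?thesis
      using iff st(2) S.m_closed[OF conj_s comm] by blast
  qed
  have decompose: "\<exists>u\<in>K. \<exists>b\<in>carrier (objs G). a = u \<oplus> idt G b" if "a \<in> carrier (arrs G)" for a
    using that arrows_over_iff[of K "carrier (objs G)" a]
    by (simp add: arrows_over_def K_iff)
  show ?thesis
  proof (rule arrs.op_idealI)
    show "arrows_over S T \<subseteq> carrier (arrs G)"
      by (auto simp: arrows_over_def)
    show "\<zero> \<in> arrows_over S T"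
      using T_rules(2) by (simp add: arrows_over_def)
  next
    fix n assume "n \<in> arrows_over S T"
    then obtain s t where st: "s \<in> S" "t \<in> T" "n = s \<oplus> idt G t" using iff by blast
    let ?t = "inv\<^bsub>objs G\<^esub> t"
    have "inv\<^bsub>arrs G\<^esub> n = (idt G ?t \<oplus> inv\<^bsub>arrs G\<^esub> s \<ominus> idt G ?t) \<oplus> idt G ?t"
      using st by (simp add: arrs.m_assoc arrs.inv_mult_group)
    then show "inv\<^bsub>arrs G\<^esub> n \<in> arrows_over S T"
      using iff dot_S[of ?t "inv\<^bsub>arrs G\<^esub> s"] st T_rules(3)[OF st(2)] T_objs S.m_inv_closed by blast
  next
    fix n n' assume "n \<in> arrows_over S T" "n' \<in> arrows_over S T"
    then obtain s t s' t' where st: "s \<in> S" "t \<in> T" "n = s \<oplus> idt G t"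
        "s' \<in> S" "t' \<in> T" "n' = s' \<oplus> idt G t'"
      using iff by metis
    have "n \<oplus> n' = (s \<oplus> (idt G t \<oplus> s' \<ominus> idt G t)) \<oplus> (idt G t \<oplus> idt G t')"
      using st by (simp add: arrs.m_assoc del: idt_simps(2,4))
    also have "\<dots> = (s \<oplus> (idt G t \<oplus> s' \<ominus> idt G t)) \<oplus> idt G (t \<otimes>\<^bsub>objs G\<^esub> t')"
      using st by simp
    finally show "n \<oplus> n' \<in> arrows_over S T"
      using iff S.m_closed[OF st(1) dot_S[OF T_objs[OF st(2)] st(4)]] T_rules(4)[OF st(2,5)] by blast
  next
    fix \<omega> n assume \<omega>: "\<omega> \<in> Om1 \<T>" and "n \<in> arrows_over S T"
    then obtain s t where st: "s \<in> S" "t \<in> T" "n = s \<oplus> idt G t" using iff by blast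
    have "un (arrs G) \<omega> n = un (arrs G) \<omega> s \<oplus> idt G (un (objs G) \<omega> t)"
      using st \<omega> by (simp add: arrs.un_mult)
    moreover have "un (arrs G) \<omega> s \<in> S"
      using S \<omega> st(1) by (simp add: subobject_def op_closed_def)
    ultimately show "un (arrs G) \<omega> n \<in> arrows_over S T"
      using iff T_rules(5)[OF \<omega> st(2)] by blast
  next
    fix a n assume a: "a \<in> carrier (arrs G)" and n: "n \<in> arrows_over S T"
    then obtain u b where ub: "u \<in> K" "b \<in> carrier (objs G)" "a = u \<oplus> idt G b"
      using decompose by blast
    have "n \<in> carrier (arrs G)" "u \<in> carrier (arrs G)"
      using n ub by (simp_all add: arrows_over_def K_iff)
    then have "a \<oplus> n \<ominus> a = u \<oplus> (idt G b \<oplus> n \<ominus> idt G b) \<ominus> u"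
      using ub by (simp add: arrs.m_assoc arrs.inv_mult_group del: idt_simps(2,4))
    then show "a \<oplus> n \<ominus> a \<in> arrows_over S T"
      using conj_fibre[OF ub(1) conj_base[OF ub(2) n]] by simp
  next
    fix \<sigma> a n assume \<sigma>: "\<sigma> \<in> Om2 \<T>" and a: "a \<in> carrier (arrs G)" and n: "n \<in> arrows_over S T"
    obtain u b where ub: "u \<in> K" "b \<in> carrier (objs G)" "a = u \<oplus> idt G b"
      using a decompose by blast
    obtain s t where st: "s \<in> S" "t \<in> T" "n = s \<oplus> idt G t" using n iff by blast
    have u_arrs: "u \<in> carrier (arrs G)" using ub by (simp add: K_iff)
    have us: "bin (arrs G) \<sigma> u s \<in> S"
      using act_S[of \<sigma> "tgt G u" s] peiffer_bin[OF \<sigma> ub(1), of s] \<sigma> st u_arrs by simp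
    have bs: "bin (arrs G) \<sigma> (idt G b) s \<in> S"
      using act_S \<sigma> ub st by blast
    have ut: "bin (arrs G) \<sigma> u (idt G t) \<in> S"
      using act_T[of "opp \<T> \<sigma>" t u] \<sigma> ub st u_arrs by (simp add: opp_closed arrs.bin_opp)
    have "bin (arrs G) \<sigma> a n =
        bin (arrs G) \<sigma> u s \<oplus> bin (arrs G) \<sigma> (idt G b) s \<oplus> bin (arrs G) \<sigma> u (idt G t)
        \<oplus> idt G (bin (objs G) \<sigma> b t)"
      using \<sigma> ub st u_arrs by (simp add: arrs.bin_mult_left arrs.bin_mult_right arrs.m_assoc)
    then show "bin (arrs G) \<sigma> a n \<in> arrows_over S T"
      using iff S.m_closed[OF S.m_closed[OF us bs] ut] T_rules(7)[OF \<sigma> ub(2) st(2)] by blast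
  qed
qed

lemma objects_over: "T = {x \<in> carrier (objs G). idt G x \<in> arrows_over S T}"
proof -
  have "\<zero> \<in> S" using S by (simp add: subobject_def op_closed_def)
  then show ?thesis
    using objs.op_idealD(1)[OF T] by (auto simp: arrows_over_def simp del: idt_simps(4))
qed

lemma ends_over:
  assumes "a \<in> arrows_over S T"
  shows "src G a \<in> T" and "tgt G a \<in> T"
proof -
  note T_rules = objs.op_idealD[OF T]
  show "src G a \<in> T" using assms by (simp add: arrows_over_def)
  obtain s t where st: "s \<in> S" "t \<in> T" "a = s \<oplus> idt G t"
    using assms arrows_over_iff[OF S_K T_rules(1)] by blast
  have "s \<in> carrier (arrs G)" "t \<in> carrier (objs G)"
    using st S_K T_rules(1) by (auto simp: K_iff)
  then show "tgt G a \<in> T"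
    using st bdry_S T_rules(4) by simp
qed

lemma arrows_over_Int_K: "arrows_over S T \<inter> K = S"
  using S_K objs.op_idealD(2)[OF T] by (auto simp: arrows_over_def K_iff)

end

context internal_groupoid_algebra
begin

lemma normal_subcrossed_module_restrict:
  assumes "normal_subcrossed_module \<T> Y X"
  shows "Y = restrict_xmod X (carrier (fibre Y)) (carrier (base Y))"
  using assms by (auto simp: normal_subcrossed_module_def subcrossed_module_def)

lemma normal_pair_of_xmod:
  assumes Y: "normal_subcrossed_module \<T> Y X"
  shows "normal_pair \<T> G (carrier (fibre Y)) (carrier (base Y))"
proof -
  obtain S T where S: "subobject \<T> S (fibre X)" and Y_eq: "Y = restrict_xmod X S T"
    and cm: "crossed_module \<T> Y"
    using Y unfolding normal_subcrossed_module_def subcrossed_module_def by blast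
  have T: "op_ideal \<T> T (objs G)"
    using Y Y_eq by (simp add: normal_subcrossed_module_def)
  have T_objs: "t \<in> carrier (objs G)" if "t \<in> T" for t
    using that objs.op_idealD(1)[OF T] by blast
  have "normal_pair \<T> G S T"
  proof
    show "S \<subseteq> K" "subobject \<T> S (arrs G)"
      using S by (auto simp: subobject_def op_closed_def K_iff)
    show "op_ideal \<T> T (objs G)" by (fact T)
    show "tgt G s \<in> T" if "s \<in> S" for s
      using crossed_module.bdry_morphism[OF cm] that Y_eq by (auto simp: morphism_def hom_def)
  next
    fix t a assume ta: "t \<in> T" "a \<in> K"
    then have "dot X t a \<oplus> neg (arrs G) a \<in> S"
      using Y Y_eq by (simp add: normal_subcrossed_module_def)
    then show "idt G t \<oplus> a \<ominus> idt G t \<ominus> a \<in> S"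
      using ta T_objs by (simp add: K_iff)
  next
    fix b s assume bs: "b \<in> carrier (objs G)" "s \<in> S"
    then have "dot X b s \<in> S"
      using Y Y_eq by (simp add: normal_subcrossed_module_def)
    then show "idt G b \<oplus> s \<ominus> idt G b \<in> S"
      using bs by simp
  qed (use Y Y_eq in \<open>simp_all add: normal_subcrossed_module_def\<close>)
  then show ?thesis using Y_eq by simp
qed

text \<open>
  Closure under composition and inversion is automatic: by \<open>cmp_eq\<close>, composites are
  \<open>b - 1\<^sub>y + a\<close>, and solving \<open>b - 1\<^sub>y + a = 1\<^sub>x\<close> for \<open>b\<close> gives \<open>b = 1\<^sub>x - a + 1\<^sub>y\<close> for the inverse.
\<close>

lemma internal_normal_subgroupoid_of_ideal:
  assumes N1: "op_ideal \<T> N1 (arrs G)" and N0: "N0 = {x \<in> carrier (objs G). idt G x \<in> N1}"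
    and ends: "\<And>a. a \<in> N1 \<Longrightarrow> src G a \<in> N0" "\<And>a. a \<in> N1 \<Longrightarrow> tgt G a \<in> N0"
  shows "internal_normal_subgroupoid \<T> (restrict_igpd G N1 N0) G"
proof -
  note N1_rules = arrs.op_idealD[OF N1]
  have N1_arrs: "a \<in> carrier (arrs G)" if "a \<in> N1" for a
    using that N1_rules(1) by blast
  have idt_ends: "idt G (src G a) \<in> N1" "idt G (tgt G a) \<in> N1" if "a \<in> N1" for a
    using ends[OF that] N0 by simp_all
  have cmp_in: "cmp G b a \<in> N1" if "a \<in> N1" "b \<in> N1" "src G b = tgt G a" for a b
    using that by (simp add: cmp_eq N1_arrs N1_rules(3,4) idt_ends del: idt_simps(4))
  have "b \<in> N1" if a: "a \<in> N1" and inv: "inverse_arrows (underlying_cat G) a b" for a b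
  proof -
    have b: "b \<in> carrier (arrs G)" "src G b = tgt G a" and cmp: "cmp G b a = idt G (src G a)"
      using inv by (simp_all add: inverse_arrows_def underlying_cat_def)
    let ?x = "idt G (src G a)" and ?y = "idt G (tgt G a)"
    have "b \<ominus> ?y \<oplus> a = ?x"
      using cmp cmp_eq[OF b(1) N1_arrs[OF a] b(2)] by simp
    then have "b \<ominus> ?y \<oplus> a \<ominus> a \<oplus> ?y = ?x \<ominus> a \<oplus> ?y" by simp
    then have "b = ?x \<ominus> a \<oplus> ?y"
      using b(1) N1_arrs[OF a] by (simp add: arrs.m_assoc del: idt_simps(4))
    then show ?thesis
      using a by (simp add: N1_rules(3,4) idt_ends)
  qed
  then have "subgroupoid (restrict_igpd G N1 N0) G"
    unfolding subgroupoid_def using N1_rules(1) ends cmp_in N0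
    by (intro exI[of _ N1] exI[of _ N0]) auto
  then show ?thesis
    using N1 by (simp add: internal_normal_subgroupoid_def)
qed

definition xmod_of_subgroupoid :: "('o, 'm, 'u, 'w) igpd \<Rightarrow> ('m, 'o, 'u, 'w) xmod" where
  "xmod_of_subgroupoid N = restrict_xmod X (carrier (arrs N) \<inter> K) (carrier (objs N))"

definition subgroupoid_of_xmod :: "('m, 'o, 'u, 'w) xmod \<Rightarrow> ('o, 'm, 'u, 'w) igpd" where
  "subgroupoid_of_xmod Y =
     restrict_igpd G (arrows_over (carrier (fibre Y)) (carrier (base Y))) (carrier (base Y))"

lemma normal_subcrossed_module_of_subgroupoid:
  assumes "internal_normal_subgroupoid \<T> N G"
  shows "normal_subcrossed_module \<T> (xmod_of_subgroupoid N) X"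
  unfolding xmod_of_subgroupoid_def
  by (rule normal_subcrossed_module_of_ideal[OF normal_subgroupoid_ideal(2-5)[OF assms]])

lemma internal_normal_subgroupoid_of_xmod:
  assumes "normal_subcrossed_module \<T> Y X"
  shows "internal_normal_subgroupoid \<T> (subgroupoid_of_xmod Y) G"
proof -
  interpret normal_pair \<T> G "carrier (fibre Y)" "carrier (base Y)"
    by (rule normal_pair_of_xmod[OF assms])
  show ?thesis
    unfolding subgroupoid_of_xmod_def
    by (rule internal_normal_subgroupoid_of_ideal[OF op_ideal_arrows_over objects_over ends_over])
qed

lemma subgroupoid_of_xmod_of_subgroupoid:
  assumes "internal_normal_subgroupoid \<T> N G"
  shows "subgroupoid_of_xmod (xmod_of_subgroupoid N) = N"
proof -
  let ?N1 = "carrier (arrs N)" and ?N0 = "carrier (objs N)"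
  note N = normal_subgroupoid_ideal[OF assms]
  note N1_rules = arrs.op_idealD[OF N(2)]
  have "arrows_over (?N1 \<inter> K) ?N0 = ?N1"
  proof
    show "arrows_over (?N1 \<inter> K) ?N0 \<subseteq> ?N1"
    proof
      fix a assume "a \<in> arrows_over (?N1 \<inter> K) ?N0"
      moreover have "?N0 \<subseteq> carrier (objs G)" using N(3) by blast
      ultimately obtain s t where "s \<in> ?N1" "t \<in> ?N0" "a = s \<oplus> idt G t"
        using arrows_over_iff[of "?N1 \<inter> K" ?N0 a] by blast
      then show "a \<in> ?N1" using N(3) N1_rules(4) by blast
    qed
    show "?N1 \<subseteq> arrows_over (?N1 \<inter> K) ?N0"
    proof
      fix a assume a: "a \<in> ?N1"
      then have "a \<in> carrier (arrs G)" "idt G (src G a) \<in> ?N1" "src G a \<in> ?N0"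
        using N1_rules(1) N(3) N(4)[OF a] by blast+
      then show "a \<in> arrows_over (?N1 \<inter> K) ?N0"
        using a by (simp add: arrows_over_def K_iff N1_rules(3,4) del: idt_simps(4))
    qed
  qed
  then show ?thesis
    using N(1) by (simp add: subgroupoid_of_xmod_def xmod_of_subgroupoid_def)
qed

lemma xmod_of_subgroupoid_of_xmod:
  assumes "normal_subcrossed_module \<T> Y X"
  shows "xmod_of_subgroupoid (subgroupoid_of_xmod Y) = Y"
proof -
  interpret normal_pair \<T> G "carrier (fibre Y)" "carrier (base Y)"
    by (rule normal_pair_of_xmod[OF assms])
  show ?thesis
    using normal_subcrossed_module_restrict[OF assms]
    by (simp add: xmod_of_subgroupoid_def subgroupoid_of_xmod_def arrows_over_Int_K)
qed


section \<open>Morphisms commuting with the inclusions\<close>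

lemma igpd_morphism_inclusion_iff:
  assumes M: "internal_normal_subgroupoid \<T> M G" and N: "internal_normal_subgroupoid \<T> N G"
  shows "igpd_morphism \<T> M N (restrict (\<lambda>a. a) (carrier (arrs M))) (restrict (\<lambda>x. x) (carrier (objs M)))
    \<longleftrightarrow> carrier (arrs M) \<subseteq> carrier (arrs N) \<and> carrier (objs M) \<subseteq> carrier (objs N)"
proof -
  define M1 M0 N1 N0 where carriers: "M1 = carrier (arrs M)" "M0 = carrier (objs M)"
    "N1 = carrier (arrs N)" "N0 = carrier (objs N)"
  note M_rules = normal_subgroupoid_ideal[OF M, folded carriers]
  have eqs: "M = restrict_igpd G M1 M0" "N = restrict_igpd G N1 N0"
    using normal_subgroupoid_ideal(1) M N by (simp_all add: carriers)
  have closed: "op_closed \<T> M1 (arrs G)" "op_closed \<T> M0 (objs G)"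
    using M_rules(2) objects_ideal[OF M_rules(2)] M_rules(3)
    by (simp_all add: op_ideal_def subobject_def)
  have "is_functor (underlying_cat M) (underlying_cat N)
      (restrict (\<lambda>x. x) M0) (restrict (\<lambda>a. a) M1)" if "M1 \<subseteq> N1" "M0 \<subseteq> N0"
    unfolding eqs
    by unfold_locales
      (use that M_rules(3-6) in \<open>auto simp: underlying_cat_def restrict_igpd_def\<close>)
  then have "igpd_morphism \<T> M N (restrict (\<lambda>a. a) M1) (restrict (\<lambda>x. x) M0) \<longleftrightarrow> M1 \<subseteq> N1 \<and> M0 \<subseteq> N0"
    using inclusion_morphism_iff[OF closed(1), of N1] inclusion_morphism_iff[OF closed(2), of N0]
    by (auto simp: igpd_morphism_def eqs)
  then show ?thesis by (simp add: carriers)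
qed

lemma xmod_morphism_inclusion_iff:
  assumes Y: "normal_subcrossed_module \<T> Y X" and Z: "normal_subcrossed_module \<T> Z X"
  shows "xmod_morphism \<T> Y Z (restrict (\<lambda>a. a) (carrier (fibre Y))) (restrict (\<lambda>b. b) (carrier (base Y)))
    \<longleftrightarrow> carrier (fibre Y) \<subseteq> carrier (fibre Z) \<and> carrier (base Y) \<subseteq> carrier (base Z)"
proof -
  define S T S' T' where carriers: "S = carrier (fibre Y)" "T = carrier (base Y)"
    "S' = carrier (fibre Z)" "T' = carrier (base Z)"
  have eqs: "Y = restrict_xmod X S T" "Z = restrict_xmod X S' T'"
    using normal_subcrossed_module_restrict Y Z by (simp_all add: carriers)
  interpret normal_pair \<T> G S T
    unfolding carriers by (rule normal_pair_of_xmod[OF Y])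
  have closed: "op_closed \<T> S (arrs G)" "op_closed \<T> T (objs G)"
    using S T by (simp_all add: op_ideal_def subobject_def)
  have "t \<in> carrier (objs G)" if "t \<in> T" for t
    using that objs.op_idealD(1)[OF T] by blast
  then have "xmod_morphism \<T> Y Z (restrict (\<lambda>a. a) S) (restrict (\<lambda>b. b) T) \<longleftrightarrow> S \<subseteq> S' \<and> T \<subseteq> T'"
    using inclusion_morphism_iff[OF closed(1), of S'] inclusion_morphism_iff[OF closed(2), of T']
      bdry_S dot_S act_S
    by (simp add: xmod_morphism_def eqs del: idt_simps)
  then show ?thesis by (simp add: carriers)
qed

lemma normal_subgroupoid_cat_eq:
  "normal_subgroupoid_cat \<T> G = inclusion_cat (\<lambda>N. internal_normal_subgroupoid \<T> N G)
     (\<lambda>N. carrier (arrs N)) (\<lambda>N. carrier (objs N))"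
  unfolding normal_subgroupoid_cat_def
  by (subst inclusion_arrows[of "\<lambda>N. internal_normal_subgroupoid \<T> N G" "igpd_morphism \<T>"])
    (auto simp: inclusion_cat_def igpd_morphism_inclusion_iff)

lemma normal_subcrossed_module_cat_eq:
  "normal_subcrossed_module_cat \<T> X = inclusion_cat (\<lambda>Y. normal_subcrossed_module \<T> Y X)
     (\<lambda>Y. carrier (fibre Y)) (\<lambda>Y. carrier (base Y))"
  unfolding normal_subcrossed_module_cat_def
  by (subst inclusion_arrows[of "\<lambda>Y. normal_subcrossed_module \<T> Y X" "xmod_morphism \<T>"])
    (auto simp: inclusion_cat_def xmod_morphism_inclusion_iff)

lemma categories_equivalent:
  "equivalent_categories (normal_subgroupoid_cat \<T> G) (normal_subcrossed_module_cat \<T> X)"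
  unfolding normal_subgroupoid_cat_eq normal_subcrossed_module_cat_eq
proof (rule inclusion_cats_equivalent[of _ _ xmod_of_subgroupoid subgroupoid_of_xmod])
qed (auto simp: normal_subcrossed_module_of_subgroupoid internal_normal_subgroupoid_of_xmod
    subgroupoid_of_xmod_of_subgroupoid xmod_of_subgroupoid_of_xmod,
    auto simp: xmod_of_subgroupoid_def subgroupoid_of_xmod_def arrows_over_def)

end

theorem corollary5p15:
  fixes \<T> :: "('u, 'w) optheory"
    and G :: "('o, 'm, 'u, 'w) igpd"
  assumes "groups_with_operations \<T>"
    and "internal_groupoid \<T> G"
  shows "equivalent_categories
    (normal_subgroupoid_cat \<T> G)
    (normal_subcrossed_module_cat \<T> (xmod_of_igpd G))"
proof -
  interpret internal_groupoid_algebra \<T> G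
    using assms by (rule internal_groupoid_algebra.intro)
  show ?thesis by (rule categories_equivalent)
qed

end
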